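(* There is no proper biharmonic Hopf cylinder in $S^3$. That is, for the Hopf fibration $\pi:S^3\to S^2$ and any immersed regular curve $\alpha:I\to S^2$ parametrized by arclength, the surface $\Sigma=\bigcup_{t\in I}\pi^{-1}(\alpha(t))$ in $S^3$ is not proper biharmonic.
   Context: All manifolds, maps and tensor fields are smooth. $S^3$ is the unit sphere with its standard metric, and $\pi:S^3\to S^2$ is the Hopf fibration regarded as a Riemannian submersion with totally geodesic fibers (so the base is the 2-sphere with the metric making $\pi$ a Riemannian submersion). $I$ is an interval. A map $\varphi:(M,g)\to(N,h)$ between Riemannian manifolds has tension field $\tau(\varphi)=\mathrm{Trace}_g\nabla d\varphi$. It is biharmonic if it is a critical point of the bienergy $E^2(\varphi,\Omega)=\frac12\int_\Omega|\tau(\varphi)|^2dx$ for every compact $\Omega\subset M$; equivalently, its bitension field $$\tau^2(\varphi)=\mathrm{Trace}_g(\nabla^\varphi\nabla^\varphi-\nabla^\varphi_{\nabla^M})\tau(\varphi)-\mathrm{Trace}_g R^N(d\varphi,\tau(\varphi))d\varphi$$ vanishes identically, where $R^N(X,Y)Z=[\nabla^N_X,\nabla^N_Y]Z-\nabla^N_{[X,Y]}Z$. A submanifold is called biharmonic if its inclusion map, taken with the induced metric, is a biharmonic isometric immersion. It is proper biharmonic if it is biharmonic and not minimal. *)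

theory Defs
  imports "HOL-Analysis.Analysis"
begin

section \<open>Smooth maps\<close>

primrec Ck_on :: "nat \<Rightarrow> 'a::real_normed_vector set \<Rightarrow> ('a \<Rightarrow> 'b::real_normed_vector) \<Rightarrow> bool" where
  "Ck_on 0 U f \<longleftrightarrow> continuous_on U f"
| "Ck_on (Suc k) U f \<longleftrightarrow>
     (\<forall>x\<in>U. f differentiable (at x)) \<and> (\<forall>v. Ck_on k U (\<lambda>x. frechet_derivative f (at x) v))"

text \<open>On a set that need not be open, smooth means: restriction of a smooth map on an open
  neighbourhood.\<close>

definition smooth_on :: "'a::real_normed_vector set \<Rightarrow> ('a \<Rightarrow> 'b::real_normed_vector) \<Rightarrow> bool" where
  "smooth_on S f \<longleftrightarrow>
     (\<exists>U g. open U \<and> S \<subseteq> U \<and> (\<forall>k. Ck_on k U g) \<and> (\<forall>x\<in>S. f x = g x))"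


section \<open>Submanifolds of Euclidean space and their Levi-Civita connection\<close>

text \<open>Manifolds are subsets of a Euclidean space. A target manifold carries the metric
  induced by the inner product; a domain manifold carries an arbitrary metric (see below).\<close>

definition tangent_space :: "'b::euclidean_space set \<Rightarrow> 'b \<Rightarrow> 'b set" where
  "tangent_space N p =
     {v. \<exists>c e. 0 < e \<and> smooth_on {-e<..<e} c \<and> c ` {-e<..<e} \<subseteq> N \<and> c 0 = p \<and>
           (c has_vector_derivative v) (at (0::real))}"

definition orth_proj :: "'b::euclidean_space set \<Rightarrow> 'b \<Rightarrow> 'b" where
  "orth_proj S v = (THE w. w \<in> S \<and> (\<forall>z\<in>S. orthogonal (v - w) z))"

definition vector_field :: "'b::euclidean_space set \<Rightarrow> ('b \<Rightarrow> 'b) \<Rightarrow> bool" where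
  "vector_field N X \<longleftrightarrow> smooth_on N X \<and> (\<forall>p\<in>N. X p \<in> tangent_space N p)"

text \<open>The derivative of a map at \<open>p\<close> within \<open>N\<close> is only determined on the tangent space of \<open>N\<close>
  at \<open>p\<close>; below it is applied to tangent vectors only. The Levi-Civita connection of the
  induced metric is the tangential part of the ambient derivative.\<close>

definition levi_civita :: "'b::euclidean_space set \<Rightarrow> ('b \<Rightarrow> 'b) \<Rightarrow> ('b \<Rightarrow> 'b) \<Rightarrow> 'b \<Rightarrow> 'b" where
  "levi_civita N X Y p =
     orth_proj (tangent_space N p) (frechet_derivative Y (at p within N) (X p))"

definition lie_bracket :: "'b::euclidean_space set \<Rightarrow> ('b \<Rightarrow> 'b) \<Rightarrow> ('b \<Rightarrow> 'b) \<Rightarrow> 'b \<Rightarrow> 'b" where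
  "lie_bracket N X Y p =
     frechet_derivative Y (at p within N) (X p) - frechet_derivative X (at p within N) (Y p)"

text \<open>The curvature \<open>R(x,y)z = [\<nabla>\<^sub>X,\<nabla>\<^sub>Y]Z - \<nabla>\<^bsub>[X,Y]\<^esub>Z\<close> at \<open>p\<close>, for any vector fields
  extending the tangent vectors \<open>x\<close>, \<open>y\<close>, \<open>z\<close>.\<close>

definition curvature :: "'b::euclidean_space set \<Rightarrow> 'b \<Rightarrow> 'b \<Rightarrow> 'b \<Rightarrow> 'b \<Rightarrow> 'b" where
  "curvature N p x y z =
     (THE w. \<forall>X Y Z. vector_field N X \<and> vector_field N Y \<and> vector_field N Z \<and>
                X p = x \<and> Y p = y \<and> Z p = z \<longrightarrow>
        w = levi_civita N X (levi_civita N Y Z) p - levi_civita N Y (levi_civita N X Z) p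
            - levi_civita N (lie_bracket N X Y) Z p)"


section \<open>Tension and bitension field in local coordinates of the domain\<close>

text \<open>Here \<open>f\<close> is a map from an open subset of \<open>\<real>\<^sup>m\<close>, with metric coefficients
  \<open>G u $ i $ j\<close> at \<open>u\<close>, into the submanifold \<open>N\<close>.\<close>

definition pd :: "'m::finite \<Rightarrow> (real^'m \<Rightarrow> 'b::real_normed_vector) \<Rightarrow> real^'m \<Rightarrow> 'b" where
  "pd i f u = frechet_derivative f (at u) (axis i 1)"

definition christoffel ::
    "(real^'m::finite \<Rightarrow> real^'m^'m) \<Rightarrow> 'm \<Rightarrow> 'm \<Rightarrow> 'm \<Rightarrow> real^'m \<Rightarrow> real" where
  "christoffel G k i j u =
     (1/2) * (\<Sum>l\<in>UNIV. matrix_inv (G u) $ k $ l *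
        (pd i (\<lambda>v. G v $ j $ l) u + pd j (\<lambda>v. G v $ i $ l) u - pd l (\<lambda>v. G v $ i $ j) u))"

definition metric_trace ::
    "(real^'m::finite \<Rightarrow> real^'m^'m) \<Rightarrow> ('m \<Rightarrow> 'm \<Rightarrow> 'b::real_vector) \<Rightarrow> real^'m \<Rightarrow> 'b" where
  "metric_trace G B u = (\<Sum>i\<in>UNIV. \<Sum>j\<in>UNIV. (matrix_inv (G u) $ i $ j) *\<^sub>R B i j)"

text \<open>The pull-back connection of \<open>f\<close> in direction of the \<open>i\<close>-th coordinate, acting on vector
  fields \<open>V\<close> along \<open>f\<close>.\<close>

definition cov :: "'b::euclidean_space set \<Rightarrow> (real^'m::finite \<Rightarrow> 'b) \<Rightarrow> 'm \<Rightarrow>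
    (real^'m \<Rightarrow> 'b) \<Rightarrow> real^'m \<Rightarrow> 'b" where
  "cov N f i V u = orth_proj (tangent_space N (f u)) (pd i V u)"

definition tension :: "'b::euclidean_space set \<Rightarrow> (real^'m::finite \<Rightarrow> real^'m^'m) \<Rightarrow>
    (real^'m \<Rightarrow> 'b) \<Rightarrow> real^'m \<Rightarrow> 'b" where
  "tension N G f u = metric_trace G
     (\<lambda>i j. cov N f i (pd j f) u - (\<Sum>k\<in>UNIV. christoffel G k i j u *\<^sub>R pd k f u)) u"

definition bitension :: "'b::euclidean_space set \<Rightarrow> (real^'m::finite \<Rightarrow> real^'m^'m) \<Rightarrow>
    (real^'m \<Rightarrow> 'b) \<Rightarrow> real^'m \<Rightarrow> 'b" where
  "bitension N G f u =
     metric_trace G (\<lambda>i j. cov N f i (cov N f j (tension N G f)) u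
        - (\<Sum>k\<in>UNIV. christoffel G k i j u *\<^sub>R cov N f k (tension N G f) u)) u
     - metric_trace G (\<lambda>i j. curvature N (f u) (pd i f u) (tension N G f u) (pd j f u)) u"

text \<open>The mean curvature vector: normalised trace of the second fundamental form, i.e. of the
  part of \<open>\<nabla>\<^sub>i \<partial>\<^sub>j f\<close> normal to the image of the derivative of \<open>f\<close>.\<close>

definition mean_curvature :: "'b::euclidean_space set \<Rightarrow> (real^'m::finite \<Rightarrow> real^'m^'m) \<Rightarrow>
    (real^'m \<Rightarrow> 'b) \<Rightarrow> real^'m \<Rightarrow> 'b" where
  "mean_curvature N G f u = (1 / real CARD('m)) *\<^sub>R metric_trace G
     (\<lambda>i j. cov N f i (pd j f) u
            - orth_proj (range (frechet_derivative f (at u))) (cov N f i (pd j f) u)) u"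


section \<open>Biharmonic maps and biharmonic immersions\<close>

definition local_param :: "'a::euclidean_space set \<Rightarrow> (real^'m::finite) set \<Rightarrow>
    (real^'m \<Rightarrow> 'a) \<Rightarrow> bool" where
  "local_param M U \<psi> \<longleftrightarrow>
     open U \<and> smooth_on U \<psi> \<and> (\<forall>u\<in>U. inj (frechet_derivative \<psi> (at u))) \<and>
     \<psi> ` U \<subseteq> M \<and> openin (top_of_set M) (\<psi> ` U) \<and> (\<exists>h. homeomorphism U (\<psi> ` U) \<psi> h)"

text \<open>A metric on \<open>M\<close> is given as \<open>g p v w\<close> for \<open>p\<close> in \<open>M\<close> and \<open>v\<close>, \<open>w\<close> tangent to \<open>M\<close> at \<open>p\<close>.\<close>

definition metric_coeffs :: "('a::euclidean_space \<Rightarrow> 'a \<Rightarrow> 'a \<Rightarrow> real) \<Rightarrow>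
    (real^'m::finite \<Rightarrow> 'a) \<Rightarrow> real^'m \<Rightarrow> real^'m^'m" where
  "metric_coeffs g \<psi> u = (\<chi> i j. g (\<psi> u) (pd i \<psi> u) (pd j \<psi> u))"

text \<open>The type argument \<open>'m\<close> is the index type of the coordinates of \<open>M\<close>, so the dimension of
  \<open>M\<close> is \<open>CARD('m)\<close>. All fields are tensorial, so they vanish iff they vanish in every local
  parametrization.\<close>

definition biharmonic_map :: "'m::finite itself \<Rightarrow> 'a::euclidean_space set \<Rightarrow>
    ('a \<Rightarrow> 'a \<Rightarrow> 'a \<Rightarrow> real) \<Rightarrow> ('a \<Rightarrow> 'b::euclidean_space) \<Rightarrow> 'b set \<Rightarrow> bool" where
  "biharmonic_map T M g \<phi> N \<longleftrightarrow>
     smooth_on M \<phi> \<and> \<phi> ` M \<subseteq> N \<and>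
     (\<forall>(U :: (real^'m) set) \<psi>. local_param M U \<psi> \<longrightarrow>
        (\<forall>u\<in>U. bitension N (metric_coeffs g \<psi>) (\<phi> \<circ> \<psi>) u = 0))"

definition immersion :: "'a::euclidean_space set \<Rightarrow> ('a \<Rightarrow> 'b::euclidean_space) \<Rightarrow> 'b set \<Rightarrow> bool" where
  "immersion M \<phi> N \<longleftrightarrow> smooth_on M \<phi> \<and> \<phi> ` M \<subseteq> N \<and>
     (\<forall>p\<in>M. inj_on (frechet_derivative \<phi> (at p within M)) (tangent_space M p))"

definition induced_metric :: "'a::euclidean_space set \<Rightarrow> ('a \<Rightarrow> 'b::euclidean_space) \<Rightarrow>
    'a \<Rightarrow> 'a \<Rightarrow> 'a \<Rightarrow> real" where
  "induced_metric M \<phi> p v w =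
     frechet_derivative \<phi> (at p within M) v \<bullet> frechet_derivative \<phi> (at p within M) w"

definition biharmonic_immersion :: "'m::finite itself \<Rightarrow> 'a::euclidean_space set \<Rightarrow>
    ('a \<Rightarrow> 'b::euclidean_space) \<Rightarrow> 'b set \<Rightarrow> bool" where
  "biharmonic_immersion T M \<phi> N \<longleftrightarrow>
     immersion M \<phi> N \<and> biharmonic_map T M (induced_metric M \<phi>) \<phi> N"

definition minimal_immersion :: "'m::finite itself \<Rightarrow> 'a::euclidean_space set \<Rightarrow>
    ('a \<Rightarrow> 'b::euclidean_space) \<Rightarrow> 'b set \<Rightarrow> bool" where
  "minimal_immersion T M \<phi> N \<longleftrightarrow>
     immersion M \<phi> N \<and>
     (\<forall>(U :: (real^'m) set) \<psi>. local_param M U \<psi> \<longrightarrow>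
        (\<forall>u\<in>U. mean_curvature N (metric_coeffs (induced_metric M \<phi>) \<psi>) (\<phi> \<circ> \<psi>) u = 0))"

definition proper_biharmonic :: "'m::finite itself \<Rightarrow> 'a::euclidean_space set \<Rightarrow>
    ('a \<Rightarrow> 'b::euclidean_space) \<Rightarrow> 'b set \<Rightarrow> bool" where
  "proper_biharmonic T M \<phi> N \<longleftrightarrow>
     biharmonic_immersion T M \<phi> N \<and> \<not> minimal_immersion T M \<phi> N"


section \<open>Hopf fibration and Hopf cylinders\<close>

abbreviation S3 :: "(complex \<times> complex) set" where
  "S3 \<equiv> sphere 0 1"

text \<open>The radius \<open>1/2\<close> makes the Hopf map a Riemannian submersion, see
  \<open>hopf_riemannian_submersion\<close>.\<close>

abbreviation S2 :: "(complex \<times> real) set" where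
  "S2 \<equiv> sphere 0 (1/2)"

definition hopf :: "complex \<times> complex \<Rightarrow> complex \<times> real" where
  "hopf p = (fst p * cnj (snd p), ((cmod (fst p))\<^sup>2 - (cmod (snd p))\<^sup>2) / 2)"

lemma hopf_in_S2:
  assumes "p \<in> S3" shows "hopf p \<in> S2"
proof -
  obtain z w where p: "p = (z, w)" by (cases p)
  have 1: "(cmod z)\<^sup>2 + (cmod w)\<^sup>2 = 1"
    using assms by (simp add: p norm_Pair)
  have "(cmod (z * cnj w))\<^sup>2 + (((cmod z)\<^sup>2 - (cmod w)\<^sup>2) / 2)\<^sup>2 = (((cmod z)\<^sup>2 + (cmod w)\<^sup>2) / 2)\<^sup>2"
    by (simp add: norm_mult power_mult_distrib field_simps power2_eq_square)
  then have "(norm (hopf p))\<^sup>2 = (1/2)\<^sup>2"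
    unfolding 1 by (simp add: p hopf_def norm_Pair power_divide)
  then have "norm (hopf p) = 1/2"
    by (rule power2_eq_imp_eq) auto
  then show ?thesis by simp
qed

lemma hopf_has_derivative:
  "(hopf has_derivative
     (\<lambda>v. (fst v * cnj (snd p) + fst p * cnj (snd v), fst p \<bullet> fst v - snd p \<bullet> snd v))) (at p)"
proof -
  have eq: "hopf = (\<lambda>p. (fst p * cnj (snd p), (fst p \<bullet> fst p - snd p \<bullet> snd p) / 2))"
    by (auto simp: hopf_def dot_square_norm)
  have c: "((\<lambda>p. cnj (snd p)) has_derivative (\<lambda>v. cnj (snd v))) (at p)" for p :: "complex \<times> complex"
    by (intro derivative_intros)
  show ?thesis
    unfolding eq
    by (rule derivative_eq_intros c refl | simp add: diff_divide_distrib inner_commute add.commute)+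
qed

text \<open>Horizontal vectors are those orthogonal to the fibre direction \<open>\<i> p\<close>.\<close>

lemma hopf_riemannian_submersion:
  assumes "p \<in> S3" "p \<bullet> v = 0" "(\<i> * fst p, \<i> * snd p) \<bullet> v = 0"
  shows "norm (frechet_derivative hopf (at p) v) = norm v"
proof -
  obtain z1 z2 w1 w2 where p: "p = (Complex z1 z2, Complex w1 w2)"
    by (metis complex.collapse prod.collapse)
  obtain a1 a2 b1 b2 where v: "v = (Complex a1 a2, Complex b1 b2)"
    by (metis complex.collapse prod.collapse)
  have 1: "z1\<^sup>2 + z2\<^sup>2 + w1\<^sup>2 + w2\<^sup>2 = 1"
    using assms(1) by (simp add: p norm_Pair cmod_power2)
  have 2: "z1*a1 + z2*a2 + w1*b1 + w2*b2 = 0"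
    using assms(2) by (simp add: p v inner_complex_def)
  have 3: "z1*a2 - z2*a1 + w1*b2 - w2*b1 = 0"
    using assms(3) by (simp add: p v inner_complex_def)
  have D: "frechet_derivative hopf (at p) v =
      (fst v * cnj (snd p) + fst p * cnj (snd v), fst p \<bullet> fst v - snd p \<bullet> snd v)"
    unfolding frechet_derivative_at[OF hopf_has_derivative, symmetric] ..
  define x y s t where "x = z1*a1 + z2*a2" and "y = z1*a2 - z2*a1"
    and "s = w1*b1 + w2*b2" and "t = w1*b2 - w2*b1"
  note xyst = this
  have 4: "s = - x" "t = - y"
    using 2 3 by (simp_all add: xyst)
  have "(a1*w1 + a2*w2 + z1*b1 + z2*b2)\<^sup>2 + (a2*w1 - a1*w2 + z2*b1 - z1*b2)\<^sup>2 + (x - s)\<^sup>2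
      = (a1\<^sup>2 + a2\<^sup>2) * (w1\<^sup>2 + w2\<^sup>2) + (b1\<^sup>2 + b2\<^sup>2) * (z1\<^sup>2 + z2\<^sup>2)
        + 2 * (x * s - y * t) + (x - s)\<^sup>2"
    unfolding xyst by (simp add: power2_eq_square algebra_simps)
  also have "\<dots> = (a1\<^sup>2 + a2\<^sup>2) * (w1\<^sup>2 + w2\<^sup>2) + (b1\<^sup>2 + b2\<^sup>2) * (z1\<^sup>2 + z2\<^sup>2)
        + (x\<^sup>2 + y\<^sup>2) + (s\<^sup>2 + t\<^sup>2)"
    unfolding 4 by (simp add: power2_eq_square algebra_simps)
  also have "\<dots> = (a1\<^sup>2 + a2\<^sup>2 + b1\<^sup>2 + b2\<^sup>2) * (z1\<^sup>2 + z2\<^sup>2 + w1\<^sup>2 + w2\<^sup>2)"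
    unfolding xyst by (simp add: power2_eq_square algebra_simps)
  finally have "(a1*w1 + a2*w2 + z1*b1 + z2*b2)\<^sup>2 + (a2*w1 - a1*w2 + z2*b1 - z1*b2)\<^sup>2 + (x - s)\<^sup>2
      = a1\<^sup>2 + a2\<^sup>2 + b1\<^sup>2 + b2\<^sup>2"
    unfolding 1 by simp
  then show ?thesis
    by (simp add: D[unfolded p v] p v norm_Pair cmod_power2 inner_complex_def xyst algebra_simps)
qed

text \<open>Since the curve \<open>\<alpha>\<close> may have self-intersections, the Hopf cylinder is an immersed surface.
  Its domain is the pull-back of the Hopf fibration along \<open>\<alpha>\<close>, immersed into the 3-sphere by the
  second projection.\<close>

definition hopf_cylinder :: "real set \<Rightarrow> (real \<Rightarrow> complex \<times> real) \<Rightarrow>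
    (real \<times> complex \<times> complex) set" where
  "hopf_cylinder I \<alpha> = {(t, p). t \<in> I \<and> p \<in> S3 \<and> hopf p = \<alpha> t}"

lemma hopf_cylinder_image:
  "snd ` hopf_cylinder I \<alpha> = (\<Union>t\<in>I. {p \<in> S3. hopf p = \<alpha> t})"
  by (force simp: hopf_cylinder_def)

end

theory Submission
  imports Defs
begin

text \<open>Write \<open>f\<close> for the immersion in a chart of the Hopf cylinder and let \<open>T\<close> be the horizontal lift of \<open>\<alpha>'\<close>. Then \<open>T\<close> and
  \<open>\<i> f\<close> form an orthonormal tangent frame with unit normal \<open>\<i> T\<close>, whose dual coframe \<open>a\<close>, \<open>b\<close>
  is closed, so the cylinder is flat and all Christoffel terms cancel in any coordinates. With the
  curvature \<open>\<kappa>\<close> of \<open>\<alpha>\<close> one has \<open>dT = - a f + (b + \<kappa> a) \<i> T\<close>, hence the tension field is \<open>\<kappa> \<i> T\<close> and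
  the bitension field is \<open>(\<kappa>'' - \<kappa>\<^sup>3) \<i> T - 2 \<kappa>' \<i> f - 3 \<kappa> \<kappa>' T\<close>. If it vanishes, then \<open>\<kappa>' = 0\<close>,
  therefore \<open>\<kappa>\<^sup>3 = \<kappa>'' = 0\<close>, and the cylinder is minimal.\<close>

section \<open>Smooth maps\<close>

text \<open>Biharmonicity and minimality are tested in every local parametrization, and a given
  chart need not be adapted to the fibres. So all fields are expanded in the coframe
  \<open>a\<close>, \<open>b\<close> of the chart at hand, with varying coefficients.
  \<open>T\<close> and \<open>\<i> f\<close> are parallel on the surface, and this makes the
  derivatives of the coefficients cancel against the Christoffel symbols. The horizontal lift does
  not come from an ODE: an explicit formula, quadratic in the point of the 3-sphere, inverts the
  derivative of the Hopf map, so \<open>T\<close> can be differentiated directly. The curve has only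
  one-sided derivatives at the ends of \<open>I\<close>, but a chart never reaches the fibres over
  them. The curvature of the target is a definite description over extensions of tangent vectors, so
  on the sphere both independence of the extension and existence of one have to be shown.\<close>

lemma frechet_derivative_cong_open:
  assumes "open U" "x \<in> U" "\<And>y. y \<in> U \<Longrightarrow> f y = g y"
  shows "frechet_derivative f (at x) = frechet_derivative g (at x)"
proof -
  have "(f has_derivative D) (at x) \<longleftrightarrow> (g has_derivative D) (at x)" for D
    using has_derivative_transform_within_open[of f D x UNIV U g]
      has_derivative_transform_within_open[of g D x UNIV U f] assms by auto
  then show ?thesis
    by (simp add: frechet_derivative_def)
qed

lemma differentiable_cong_open:
  assumes "open U" "x \<in> U" "\<And>y. y \<in> U \<Longrightarrow> f y = g y"
  shows "f differentiable (at x) \<longleftrightarrow> g differentiable (at x)"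
  using has_derivative_transform_within_open[of f _ x UNIV U g]
    has_derivative_transform_within_open[of g _ x UNIV U f] assms
  by (auto simp: differentiable_def)

lemma Ck_on_cong:
  assumes "open U" "\<And>x. x \<in> U \<Longrightarrow> f x = g x"
  shows "Ck_on k U f \<longleftrightarrow> Ck_on k U g"
  using assms(2)
proof (induction k arbitrary: f g)
  case 0
  then show ?case by (auto intro: continuous_on_cong)
next
  case (Suc k)
  have "f differentiable (at x) \<longleftrightarrow> g differentiable (at x)" if "x \<in> U" for x
    using differentiable_cong_open[OF assms(1) that Suc.prems] by simp
  moreover have "Ck_on k U (\<lambda>x. frechet_derivative f (at x) v)
      \<longleftrightarrow> Ck_on k U (\<lambda>x. frechet_derivative g (at x) v)" for v
    by (rule Suc.IH) (simp add: frechet_derivative_cong_open[OF assms(1) _ Suc.prems])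
  ultimately show ?case by simp
qed

lemma smooth_on_open_iff:
  assumes "open U"
  shows "smooth_on U f \<longleftrightarrow> (\<forall>k. Ck_on k U f)"
proof
  have mono: "Ck_on k V g \<Longrightarrow> U \<subseteq> V \<Longrightarrow> Ck_on k U g" for k V and g :: "'a \<Rightarrow> 'b"
    by (induction k arbitrary: g) (auto intro: continuous_on_subset)
  assume "smooth_on U f"
  then obtain V g where "U \<subseteq> V" "\<forall>k. Ck_on k V g" and eq: "\<And>x. x \<in> U \<Longrightarrow> f x = g x"
    by (auto simp: smooth_on_def)
  then have "Ck_on k U g" for k by (blast intro: mono)
  then show "\<forall>k. Ck_on k U f" using Ck_on_cong[OF assms, of f g] eq by auto
qed (use assms in \<open>auto simp: smooth_on_def\<close>)

lemma Ck_on_bounded_linear: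
  assumes "bounded_linear L" "open U"
  shows "Ck_on k U f \<Longrightarrow> Ck_on k U (\<lambda>x. L (f x))"
proof (induction k arbitrary: f)
  case 0
  then show ?case
    using assms(1) by (simp add: linear_continuous_on_compose bounded_linear.continuous_on)
next
  case (Suc k)
  have D: "((\<lambda>x. L (f x)) has_derivative (\<lambda>v. L (frechet_derivative f (at x) v))) (at x)"
    if "x \<in> U" for x
    using Suc.prems that
    by (intro bounded_linear.has_derivative[OF assms(1)]) (simp add: frechet_derivative_works)
  have "Ck_on k U (\<lambda>x. L (frechet_derivative f (at x) v))" for v
    using Suc by simp
  then have "Ck_on k U (\<lambda>x. frechet_derivative (\<lambda>x. L (f x)) (at x) v)" for v
    by (subst Ck_on_cong[OF assms(2), where g = "\<lambda>x. L (frechet_derivative f (at x) v)"])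
      (simp_all add: frechet_derivative_at[OF D, symmetric])
  then show ?case using D by (auto simp: differentiable_def)
qed

lemma Ck_on_const: "open U \<Longrightarrow> Ck_on k U (\<lambda>x. c)"
  by (induction k arbitrary: c) auto

lemma Ck_on_affine:
  assumes "bounded_linear L"
  shows "Ck_on k UNIV (\<lambda>x. c + L x)"
proof (cases k)
  case 0
  then show ?thesis
    using assms by (auto intro!: continuous_intros simp: linear_continuous_on)
next
  case (Suc j)
  have D: "((\<lambda>x. c + L x) has_derivative L) (at x)" for x
    by (auto intro!: derivative_eq_intros bounded_linear_imp_has_derivative assms)
  show ?thesis
    using Suc D by (auto simp: differentiable_def frechet_derivative_at[OF D, symmetric] Ck_on_const)
qed

text \<open>Differentiation replaces the pair \<open>x\<close>, \<open>y\<close> by multiples of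
  \<open>y\<close>, \<open>x\<close>, so the induction closes when both are arbitrary. Great circles
  have this form.\<close>

lemma Ck_on_cos_sin: "Ck_on k UNIV (\<lambda>s::real. cos (w * s) *\<^sub>R x + sin (w * s) *\<^sub>R y)"
proof (induction k arbitrary: x y)
  case 0
  then show ?case by (auto intro!: continuous_intros)
next
  case (Suc k)
  have D: "((\<lambda>s. cos (w * s) *\<^sub>R x + sin (w * s) *\<^sub>R y) has_derivative
     (\<lambda>h. cos (w * s) *\<^sub>R ((w * h) *\<^sub>R y) + sin (w * s) *\<^sub>R ((- w * h) *\<^sub>R x))) (at s)" for s
    by (auto intro!: derivative_eq_intros simp: algebra_simps)
  show ?case
    using D Suc.IH[of "(w * _) *\<^sub>R y" "(- w * _) *\<^sub>R x"]
    by (simp add: differentiable_def frechet_derivative_at[OF D, symmetric]) blast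
qed

text \<open>On the unit sphere this is the tangential projection of the constant field
  \<open>x\<close>; such fields extend given tangent vectors when \<open>curvature\<close> is
  evaluated.\<close>

lemma smooth_on_const_diff_proj:
  fixes x :: "'a::euclidean_space"
  shows "smooth_on S (\<lambda>q. x - (x \<bullet> q) *\<^sub>R q)"
proof -
  have D: "((\<lambda>q. x - (x \<bullet> q) *\<^sub>R q) has_derivative
     (\<lambda>v. 0 + (- (x \<bullet> q) *\<^sub>R v - (x \<bullet> v) *\<^sub>R q))) (at q)" for q
    by (auto intro!: derivative_eq_intros)
  have bl: "bounded_linear (\<lambda>q. - (x \<bullet> q) *\<^sub>R v - (x \<bullet> v) *\<^sub>R q)" for v
    unfolding linear_conv_bounded_linear[symmetric]
    by (intro linearI) (auto simp: algebra_simps)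
  have "Ck_on k UNIV (\<lambda>q. x - (x \<bullet> q) *\<^sub>R q)" for k
  proof (cases k)
    case 0
    then show ?thesis by (auto intro!: continuous_intros)
  next
    case (Suc j)
    show ?thesis
      using D Ck_on_affine[OF bl, of _ 0]
      by (auto simp: Suc differentiable_def frechet_derivative_at[OF D, symmetric])
  qed
  then show ?thesis by (auto simp: smooth_on_def)
qed

section \<open>Symmetry of second derivatives\<close>

text \<open>Two applications of the mean value theorem, in either order, turn the second difference
  over a small parallelogram into \<open>h * h\<close> times a value of a mixed derivative;
  continuity at \<open>u\<close> makes the two agree.\<close>

lemma symmetric_second_derivative_real:
  fixes f :: "'a::real_normed_vector \<Rightarrow> real"
  assumes "open U" "u \<in> U"
    and A: "\<And>x. x \<in> U \<Longrightarrow> (f has_derivative A x) (at x)"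
    and B: "\<And>x. x \<in> U \<Longrightarrow> ((\<lambda>x. A x v) has_derivative B x) (at x)"
    and C: "\<And>x. x \<in> U \<Longrightarrow> ((\<lambda>x. A x w) has_derivative C x) (at x)"
    and cB: "continuous_on U (\<lambda>x. B x w)" and cC: "continuous_on U (\<lambda>x. C x v)"
  shows "B u w = C u v"
proof -
  have *: "\<exists>s s'. 0 < s \<and> s < h \<and> 0 < s' \<and> s' < h \<and>
      f (u + h *\<^sub>R v + h *\<^sub>R w) - f (u + h *\<^sub>R v) - f (u + h *\<^sub>R w) + f u
        = h * h * B (u + s *\<^sub>R v + s' *\<^sub>R w) w"
    if h: "0 < h" and in_U: "\<And>s s'. 0 \<le> s \<Longrightarrow> s \<le> h \<Longrightarrow> 0 \<le> s' \<Longrightarrow> s' \<le> h \<Longrightarrow> u + s *\<^sub>R v + s' *\<^sub>R w \<in> U"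
      and A: "\<And>x. x \<in> U \<Longrightarrow> (f has_derivative A x) (at x)"
      and B: "\<And>x. x \<in> U \<Longrightarrow> ((\<lambda>x. A x v) has_derivative B x) (at x)"
    for h v w B
  proof -
    have line: "((\<lambda>s. F (x + s *\<^sub>R y)) has_real_derivative F' y) (at s)"
      if "(F has_derivative F') (at (x + s *\<^sub>R y))" for F :: "'a \<Rightarrow> real" and F' x y and s :: real
    proof -
      have "((\<lambda>s. x + s *\<^sub>R y) has_derivative (\<lambda>h. h *\<^sub>R y)) (at s)"
        by (auto intro!: derivative_eq_intros)
      from has_derivative_compose[OF this that]
      have "((\<lambda>s. F (x + s *\<^sub>R y)) has_derivative (\<lambda>h. F' (h *\<^sub>R y))) (at s)" .
      then show ?thesis
        using linear_simps(5)[OF has_derivative_bounded_linear[OF that]]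
        by (simp add: has_field_derivative_def mult.commute[of _ "F' y"])
    qed
    have "((\<lambda>s. f (u + h *\<^sub>R w + s *\<^sub>R v) - f (u + s *\<^sub>R v)) has_real_derivative
        A (u + h *\<^sub>R w + s *\<^sub>R v) v - A (u + s *\<^sub>R v) v) (at s)" if "0 \<le> s" "s \<le> h" for s
      using in_U[of s h] in_U[of s 0] that h
      by (intro derivative_intros line A) (auto simp: algebra_simps)
    from MVT2[OF h this] obtain s where s: "0 < s" "s < h"
      and 1: "f (u + h *\<^sub>R w + h *\<^sub>R v) - f (u + h *\<^sub>R v) - (f (u + h *\<^sub>R w) - f u)
         = h * (A (u + h *\<^sub>R w + s *\<^sub>R v) v - A (u + s *\<^sub>R v) v)" by auto
    have "((\<lambda>s'. A (u + s *\<^sub>R v + s' *\<^sub>R w) v) has_real_derivative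
        B (u + s *\<^sub>R v + s' *\<^sub>R w) w) (at s')" if "0 \<le> s'" "s' \<le> h" for s'
      using in_U[of s s'] that s
      by (intro line[where F = "\<lambda>x. A x v"] B) (auto simp: algebra_simps)
    from MVT2[OF h this] obtain s' where "0 < s'" "s' < h"
      and "A (u + s *\<^sub>R v + h *\<^sub>R w) v - A (u + s *\<^sub>R v) v = h * B (u + s *\<^sub>R v + s' *\<^sub>R w) w"
      by auto
    with s 1 show ?thesis by (intro exI[of _ s] exI[of _ s']) (auto simp: algebra_simps)
  qed
  have "\<bar>B u w - C u v\<bar> \<le> e" if "0 < e" for e
  proof -
    have lim: "((\<lambda>x. B x w) \<longlongrightarrow> B u w) (nhds u)" "((\<lambda>x. C x v) \<longlongrightarrow> C u v) (nhds u)"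
      using cB cC assms(1,2) tendsto_at_iff_tendsto_nhds[of "\<lambda>x. B x w" u]
        tendsto_at_iff_tendsto_nhds[of "\<lambda>x. C x v" u]
      by (auto simp: continuous_on_eq_continuous_at isCont_def)
    have "\<forall>\<^sub>F x in nhds u. x \<in> U \<and> dist (B x w) (B u w) < e / 2 \<and> dist (C x v) (C u v) < e / 2"
      using assms(1,2) that
      by (intro eventually_conj eventually_nhds_in_open tendstoD[OF lim(1)] tendstoD[OF lim(2)]) auto
    then obtain d where d: "0 < d" and dU: "\<And>x. dist x u < d \<Longrightarrow> x \<in> U"
      and dB: "\<And>x. dist x u < d \<Longrightarrow> \<bar>B x w - B u w\<bar> < e / 2"
      and dC: "\<And>x. dist x u < d \<Longrightarrow> \<bar>C x v - C u v\<bar> < e / 2"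
      by (auto simp: eventually_nhds_metric dist_real_def)
    \<comment> \<open>With this size the whole parallelogram lies in the ball of radius
      \<open>d\<close>; the summand 1 keeps the denominator positive when \<open>v\<close> and
      \<open>w\<close> vanish.\<close>
    define h where "h = d / (2 * (norm v + norm w + 1))"
    have h: "0 < h" using d by (simp add: h_def add_nonneg_pos)
    have near: "dist (u + s *\<^sub>R v + s' *\<^sub>R w) u < d" if "0 \<le> s" "s \<le> h" "0 \<le> s'" "s' \<le> h" for s s'
    proof -
      have "norm (s *\<^sub>R v + s' *\<^sub>R w) \<le> s * norm v + s' * norm w"
        using that norm_triangle_ineq[of "s *\<^sub>R v" "s' *\<^sub>R w"] by simp
      also have "\<dots> \<le> h * norm v + h * norm w"
        using that by (intro add_mono mult_right_mono) auto
      also have "\<dots> < h * (2 * (norm v + norm w + 1))"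
        using h by (simp add: algebra_simps add_nonneg_pos)
      also have "\<dots> = d" by (simp add: h_def add_nonneg_eq_0_iff field_simps)
      finally show ?thesis by (simp add: dist_norm algebra_simps)
    qed
    have near': "dist (u + s *\<^sub>R w + s' *\<^sub>R v) u < d" if "0 \<le> s" "s \<le> h" "0 \<le> s'" "s' \<le> h" for s s'
      using near[of s' s] that by (simp add: algebra_simps)
    obtain s s' where 1: "0 < s" "s < h" "0 < s'" "s' < h"
      "f (u + h *\<^sub>R v + h *\<^sub>R w) - f (u + h *\<^sub>R v) - f (u + h *\<^sub>R w) + f u
        = h * h * B (u + s *\<^sub>R v + s' *\<^sub>R w) w"
      using *[OF h dU[OF near] A B] by blast
    obtain r r' where 2: "0 < r" "r < h" "0 < r'" "r' < h"
      "f (u + h *\<^sub>R w + h *\<^sub>R v) - f (u + h *\<^sub>R w) - f (u + h *\<^sub>R v) + f u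
        = h * h * C (u + r *\<^sub>R w + r' *\<^sub>R v) v"
      using *[OF h dU[OF near'] A C] by blast
    have "h * h * B (u + s *\<^sub>R v + s' *\<^sub>R w) w = h * h * C (u + r *\<^sub>R w + r' *\<^sub>R v) v"
      using 1(5) 2(5) by (simp add: algebra_simps)
    then have "B (u + s *\<^sub>R v + s' *\<^sub>R w) w = C (u + r *\<^sub>R w + r' *\<^sub>R v) v"
      using h by simp
    then show ?thesis
      using dB[OF near, of s s'] dC[OF near', of r r'] 1 2 by (auto simp: abs_if split: if_splits)
  qed
  then show ?thesis
    using field_le_epsilon[of "\<bar>B u w - C u v\<bar>" 0] by auto
qed

lemma symmetric_second_derivative:
  fixes f :: "'a::real_normed_vector \<Rightarrow> 'b::euclidean_space"
  assumes "open U" "u \<in> U" "Ck_on 2 U f"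
  shows "frechet_derivative (\<lambda>x. frechet_derivative f (at x) v) (at u) w
       = frechet_derivative (\<lambda>x. frechet_derivative f (at x) w) (at u) v"
proof (rule euclidean_eqI)
  fix b :: 'b
  let ?D = "\<lambda>v x. frechet_derivative f (at x) v"
  have C2: "\<forall>x\<in>U. f differentiable (at x)" "\<forall>x\<in>U. ?D v differentiable (at x)"
      "continuous_on U (\<lambda>x. frechet_derivative (?D v) (at x) w)" for v w
    using assms(3) by (simp_all add: numeral_2_eq_2)
  show "frechet_derivative (?D v) (at u) w \<bullet> b = frechet_derivative (?D w) (at u) v \<bullet> b"
    by (rule symmetric_second_derivative_real[OF assms(1,2), where f = "\<lambda>x. f x \<bullet> b"
          and A = "\<lambda>x v. ?D v x \<bullet> b"])
      (use C2 in \<open>auto intro!: has_derivative_inner_left continuous_intros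
         simp: frechet_derivative_works\<close>)
qed

section \<open>The unit sphere as a submanifold\<close>

text \<open>One inclusion differentiates \<open>c s \<bullet> c s = 1\<close>. For the other, a
  nonzero \<open>v\<close> is the velocity of the great circle in direction \<open>v\<close> run at
  angular speed \<open>norm v\<close>.\<close>

lemma tangent_space_sphere:
  fixes p :: "'a::euclidean_space"
  assumes "p \<in> sphere 0 1"
  shows "tangent_space (sphere 0 1) p = {v. v \<bullet> p = 0}"
proof safe
  fix v assume "v \<in> tangent_space (sphere 0 1) p"
  then obtain c e where e: "0 < e" and c: "c ` {-e<..<e} \<subseteq> sphere 0 1" "c 0 = p"
    and D: "(c has_vector_derivative v) (at 0)"
    by (auto simp: tangent_space_def)
  have "((\<lambda>s. c s \<bullet> c s) has_vector_derivative c 0 \<bullet> v + v \<bullet> c 0) (at 0)"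
    by (rule bounded_bilinear.has_vector_derivative[OF bounded_bilinear_inner D D])
  moreover have "((\<lambda>s. c s \<bullet> c s) has_vector_derivative 0) (at 0)"
    by (rule has_vector_derivative_transform_within_open[of "\<lambda>_. 1" _ _ "{-e<..<e}"])
      (use e c in \<open>auto simp: dot_square_norm image_subset_iff\<close>)
  ultimately show "v \<bullet> p = 0"
    using vector_derivative_unique_at c(2) by (fastforce simp: inner_commute)
next
  fix v assume v: "v \<bullet> p = 0"
  let ?w = "norm v"
  let ?c = "\<lambda>s. cos (?w * s) *\<^sub>R p + sin (?w * s) *\<^sub>R ((1 / ?w) *\<^sub>R v)"
  have pp: "p \<bullet> p = 1" using assms by (simp add: dot_square_norm)
  show "v \<in> tangent_space (sphere 0 1) p"
  proof (cases "v = 0")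
    case False
    then have "(v \<bullet> v) = ?w * ?w" "?w \<noteq> 0" by (auto simp: dot_square_norm power2_eq_square)
    then have "?c s \<bullet> ?c s = (cos (?w * s))\<^sup>2 + (sin (?w * s))\<^sup>2" for s
      using v pp by (simp add: inner_add_left inner_add_right inner_commute power2_eq_square)
    then have "?c s \<in> sphere 0 1" for s
      by (simp add: norm_eq_sqrt_inner)
    moreover have "smooth_on S ?c" for S
      using Ck_on_cos_sin[of _ ?w p "(1 / ?w) *\<^sub>R v"] by (auto simp: smooth_on_def)
    moreover have "(?c has_vector_derivative v) (at 0)"
      using False by (auto intro!: derivative_eq_intros)
    ultimately show ?thesis
      unfolding tangent_space_def by (intro CollectI exI[of _ ?c] exI[of _ 1]) auto
  next
    case True
    have "smooth_on S (\<lambda>_::real. p)" for S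
      unfolding smooth_on_def by (intro exI[of _ UNIV] exI[of _ "\<lambda>_. p"]) (simp add: Ck_on_const)
    then show ?thesis
      unfolding tangent_space_def using True assms
      by (intro CollectI exI[of _ "\<lambda>_. p"] exI[of _ 1]) auto
  qed
qed

lemma orth_proj_eqI:
  assumes "subspace S" "w \<in> S" "\<And>z. z \<in> S \<Longrightarrow> orthogonal (v - w) z"
  shows "orth_proj S v = w"
  unfolding orth_proj_def
proof (rule the_equality)
  fix w' assume w': "w' \<in> S \<and> (\<forall>z\<in>S. orthogonal (v - w') z)"
  have "w - w' \<in> S" using w' assms by (simp add: subspace_diff)
  then have "(v - w') \<bullet> (w - w') = 0" "(v - w) \<bullet> (w - w') = 0"
    using w' assms by (auto simp: orthogonal_def)
  then have "(w - w') \<bullet> (w - w') = 0" by (simp add: inner_diff_left)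
  then show "w' = w" by simp
qed (use assms in auto)

lemma orth_proj_sphere:
  fixes p :: "'a::euclidean_space"
  assumes "p \<in> sphere 0 1"
  shows "orth_proj (tangent_space (sphere 0 1) p) v = v - (v \<bullet> p) *\<^sub>R p"
proof (rule orth_proj_eqI)
  have "p \<bullet> p = 1" using assms by (simp add: dot_square_norm)
  then show "v - (v \<bullet> p) *\<^sub>R p \<in> tangent_space (sphere 0 1) p"
    by (simp add: tangent_space_sphere[OF assms] inner_diff_left)
qed (auto simp: tangent_space_sphere[OF assms] orthogonal_def inner_commute inner_add_right
       intro!: subspaceI)

text \<open>The derivative within \<open>M\<close> is not unique, but its values on velocities of maps into \<open>M\<close> are.\<close>

lemma frechet_derivative_within_chain:
  fixes F :: "'b::real_normed_vector \<Rightarrow> 'c::real_normed_vector" and \<psi> :: "'a::real_normed_vector \<Rightarrow> 'b"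
  assumes "open U" "u \<in> U" "\<psi> ` U \<subseteq> M" "F differentiable (at (\<psi> u) within M)"
    and D: "(\<psi> has_derivative \<psi>') (at u)" and H: "((\<lambda>x. F (\<psi> x)) has_derivative H) (at u)"
  shows "frechet_derivative F (at (\<psi> u) within M) (\<psi>' v) = H v"
proof -
  have F: "(F has_derivative frechet_derivative F (at (\<psi> u) within M)) (at (\<psi> u) within \<psi> ` U)"
    using assms(3,4) by (meson frechet_derivative_works has_derivative_subset)
  have "((\<lambda>x. F (\<psi> x)) has_derivative (\<lambda>v. frechet_derivative F (at (\<psi> u) within M) (\<psi>' v))) (at u within U)"
    by (rule has_derivative_in_compose[OF has_derivative_at_withinI[OF D] F])
  then have "((\<lambda>x. F (\<psi> x)) has_derivative (\<lambda>v. frechet_derivative F (at (\<psi> u) within M) (\<psi>' v))) (at u)"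
    using at_within_open[OF assms(2,1)] by simp
  from fun_cong[OF has_derivative_unique[OF this H]] show ?thesis .
qed

text \<open>A tangent vector is the velocity of a curve in \<open>N\<close>, along which
  \<open>F\<close> coincides with \<open>G\<close>; so intrinsic derivatives may be computed with an
  ambient extension.\<close>

lemma frechet_derivative_within_tangent:
  assumes "v \<in> tangent_space N p" "p \<in> N"
    and "(G has_derivative G') (at p)" "\<And>q. q \<in> N \<Longrightarrow> F q = G q"
  shows "frechet_derivative F (at p within N) v = G' v"
proof -
  from assms(1) obtain c e where e: "0 < e" and c: "c ` {-e<..<e} \<subseteq> N" "c 0 = p"
    and D: "(c has_vector_derivative v) (at 0)"
    by (auto simp: tangent_space_def)
  have "(F has_derivative G') (at p within N)"
    by (rule has_derivative_transform[OF assms(2,4) has_derivative_at_withinI[OF assms(3)]])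
  then have F: "F differentiable (at (c 0) within N)"
    using c(2) by (auto simp: differentiable_def)
  have "((\<lambda>s. G (c s)) has_derivative (\<lambda>h. G' (h *\<^sub>R v))) (at 0)"
    by (rule has_derivative_compose[OF D[unfolded has_vector_derivative_def]])
      (unfold c(2), rule assms(3))
  then have "((\<lambda>s. F (c s)) has_derivative (\<lambda>h. G' (h *\<^sub>R v))) (at 0)"
    by (rule has_derivative_transform_within_open[of _ _ _ _ "{-e<..<e}"])
      (use e c assms(4) in \<open>auto simp: image_subset_iff\<close>)
  from frechet_derivative_within_chain[OF _ _ c(1) F D[unfolded has_vector_derivative_def] this, of 1]
  show ?thesis using e c(2) by simp
qed

section \<open>Curvature of the unit sphere\<close>

text \<open>Differentiability is known for derivatives of \<open>Z\<close> in a fixed direction.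
  Expanding \<open>Y q\<close> in the standard basis reduces the varying direction to finitely many
  fixed ones and the product rule.\<close>

lemma has_derivative_frechet_derivative_apply:
  fixes Z :: "'a::euclidean_space \<Rightarrow> 'b::real_normed_vector"
  assumes U: "open U" "p \<in> U" and Z: "Ck_on 2 U Z"
    and Y: "(Y has_derivative Y') (at p)"
  shows "((\<lambda>q. frechet_derivative Z (at q) (Y q)) has_derivative
     (\<lambda>x. frechet_derivative (\<lambda>q. frechet_derivative Z (at q) (Y p)) (at p) x
        + frechet_derivative Z (at p) (Y' x))) (at p)"
proof -
  let ?D = "\<lambda>v q. frechet_derivative Z (at q) v"
  have dZ: "Z differentiable (at q)" "?D v differentiable (at q)" if "q \<in> U" for v q
    using Z that by (simp_all add: numeral_2_eq_2)
  have expand: "?D v q = (\<Sum>b\<in>Basis. (v \<bullet> b) *\<^sub>R ?D b q)" if "q \<in> U" for v q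
    using linear_frechet_derivative[OF dZ(1)[OF that]]
    by (subst euclidean_representation[of v, symmetric]) (simp add: linear_sum linear_scale)
  have D: "(?D b has_derivative frechet_derivative (?D b) (at p)) (at p)" for b
    using dZ(2)[OF U(2)] frechet_derivative_works by blast
  have "((\<lambda>q. \<Sum>b\<in>Basis. (Y p \<bullet> b) *\<^sub>R ?D b q) has_derivative
     (\<lambda>x. \<Sum>b\<in>Basis. (Y p \<bullet> b) *\<^sub>R frechet_derivative (?D b) (at p) x)) (at p)"
    by (intro derivative_intros D)
  then have "(?D (Y p) has_derivative
     (\<lambda>x. \<Sum>b\<in>Basis. (Y p \<bullet> b) *\<^sub>R frechet_derivative (?D b) (at p) x)) (at p)"
    by (rule has_derivative_transform_within_open[OF _ U]) (simp add: expand[symmetric])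
  then have S: "frechet_derivative (?D (Y p)) (at p) x
      = (\<Sum>b\<in>Basis. (Y p \<bullet> b) *\<^sub>R frechet_derivative (?D b) (at p) x)" for x
    by (simp add: frechet_derivative_at[symmetric])
  have "((\<lambda>q. \<Sum>b\<in>Basis. (Y q \<bullet> b) *\<^sub>R ?D b q) has_derivative
     (\<lambda>x. \<Sum>b\<in>Basis. (Y p \<bullet> b) *\<^sub>R frechet_derivative (?D b) (at p) x + (Y' x \<bullet> b) *\<^sub>R ?D b p)) (at p)"
    by (intro derivative_intros D has_derivative_scaleR has_derivative_inner_left Y)
  then have "((\<lambda>q. ?D (Y q) q) has_derivative
     (\<lambda>x. \<Sum>b\<in>Basis. (Y p \<bullet> b) *\<^sub>R frechet_derivative (?D b) (at p) x + (Y' x \<bullet> b) *\<^sub>R ?D b p)) (at p)"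
    by (rule has_derivative_transform_within_open[OF _ U]) (simp add: expand[symmetric])
  then show ?thesis
    by (simp add: S sum.distrib expand[OF U(2), of "Y' _", symmetric])
qed

text \<open>Collects what computing with an ambient extension requires. The last property, the
  normal part of the derivative, comes from differentiating \<open>G q \<bullet> q = 0\<close> along
  the sphere.\<close>

lemma vector_field_sphere_extension:
  assumes "vector_field (sphere 0 1) (X :: 'a::euclidean_space \<Rightarrow> 'a)"
  obtains U G where "open U" "sphere 0 1 \<subseteq> U" "Ck_on 2 U G"
    "\<And>q. q \<in> sphere 0 1 \<Longrightarrow> X q = G q"
    "\<And>q. q \<in> U \<Longrightarrow> (G has_derivative frechet_derivative G (at q)) (at q)"
    "\<And>q. q \<in> sphere 0 1 \<Longrightarrow> G q \<bullet> q = 0"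
    "\<And>q v. q \<in> sphere 0 1 \<Longrightarrow> v \<bullet> q = 0 \<Longrightarrow> frechet_derivative X (at q within sphere 0 1) v = frechet_derivative G (at q) v"
    "\<And>q v. q \<in> sphere 0 1 \<Longrightarrow> v \<bullet> q = 0 \<Longrightarrow> frechet_derivative G (at q) v \<bullet> q = - (G q \<bullet> v)"
proof -
  from assms obtain U G where G: "open U" "sphere 0 1 \<subseteq> U" "\<And>k. Ck_on k U G"
    "\<And>q. q \<in> sphere 0 1 \<Longrightarrow> X q = G q"
    unfolding vector_field_def smooth_on_def by metis
  have D: "(G has_derivative frechet_derivative G (at q)) (at q)" if "q \<in> U" for q
    using that G(3)[of 1] by (simp add: frechet_derivative_works)
  have tan: "G q \<bullet> q = 0" if "q \<in> sphere 0 1" for q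
  proof -
    have "X q \<in> tangent_space (sphere 0 1) q"
      using assms that by (simp add: vector_field_def)
    then show ?thesis
      unfolding tangent_space_sphere[OF that] G(4)[OF that] by simp
  qed
  have 1: "frechet_derivative X (at q within sphere 0 1) v = frechet_derivative G (at q) v"
    if "q \<in> sphere 0 1" "v \<bullet> q = 0" for q v
    using that G(2,4) D
    by (intro frechet_derivative_within_tangent[where G = G]) (auto simp: tangent_space_sphere)
  have 2: "frechet_derivative G (at q) v \<bullet> q = - (G q \<bullet> v)"
    if q: "q \<in> sphere 0 1" and v: "v \<bullet> q = 0" for q v
  proof -
    have vt: "v \<in> tangent_space (sphere 0 1) q" using v by (simp add: tangent_space_sphere[OF q])
    have "((\<lambda>q. G q \<bullet> q) has_derivative (\<lambda>v. G q \<bullet> v + frechet_derivative G (at q) v \<bullet> q)) (at q)"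
      by (rule has_derivative_inner[OF D has_derivative_ident]) (use q G(2) in auto)
    from frechet_derivative_within_tangent[OF vt q this, of "\<lambda>_. 0"]
      frechet_derivative_within_tangent[OF vt q has_derivative_const[of 0], of "\<lambda>_. 0"] tan
    show ?thesis by (metis add.commute add_eq_0_iff)
  qed
  show ?thesis by (rule that[OF G(1,2) G(3)[of 2] G(4) D tan 1 2])
qed

text \<open>The Gauss equation. The ambient space is flat: second derivatives of \<open>Z'\<close>
  cancel by symmetry, first-order terms cancel against the bracket. What remains comes from
  differentiating the normal part that the inner projection removes.\<close>

lemma curvature_sphere_fields:
  fixes X Y Z :: "'a::euclidean_space \<Rightarrow> 'a"
  defines "N \<equiv> sphere 0 1"
  assumes p: "p \<in> N" and "vector_field N X" "vector_field N Y" "vector_field N Z"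
  shows "levi_civita N X (levi_civita N Y Z) p - levi_civita N Y (levi_civita N X Z) p
            - levi_civita N (lie_bracket N X Y) Z p = (Y p \<bullet> Z p) *\<^sub>R X p - (X p \<bullet> Z p) *\<^sub>R Y p"
proof -
  obtain UZ Z' where Z: "open UZ" "N \<subseteq> UZ" "Ck_on 2 UZ Z'" "\<And>q. q \<in> N \<Longrightarrow> Z q = Z' q"
    "\<And>q. q \<in> UZ \<Longrightarrow> (Z' has_derivative frechet_derivative Z' (at q)) (at q)"
    "\<And>q. q \<in> N \<Longrightarrow> Z' q \<bullet> q = 0"
    "\<And>q v. q \<in> N \<Longrightarrow> v \<bullet> q = 0 \<Longrightarrow> frechet_derivative Z (at q within N) v = frechet_derivative Z' (at q) v"
    "\<And>q v. q \<in> N \<Longrightarrow> v \<bullet> q = 0 \<Longrightarrow> frechet_derivative Z' (at q) v \<bullet> q = - (Z' q \<bullet> v)"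
    using assms(5) unfolding N_def by (rule vector_field_sphere_extension) blast
  have pp: "p \<bullet> p = 1" using p by (simp add: N_def dot_square_norm)
  have proj: "orth_proj (tangent_space N q) v = v - (v \<bullet> q) *\<^sub>R q" if "q \<in> N" for q v
    using orth_proj_sphere that unfolding N_def by blast
  have *: "levi_civita N X (levi_civita N Y Z) p =
      frechet_derivative (\<lambda>q. frechet_derivative Z' (at q) (Y p)) (at p) (X p)
      + frechet_derivative Z' (at p) (frechet_derivative Y (at p within N) (X p))
      + (Z p \<bullet> Y p) *\<^sub>R X p
      - ((frechet_derivative (\<lambda>q. frechet_derivative Z' (at q) (Y p)) (at p) (X p)
      + frechet_derivative Z' (at p) (frechet_derivative Y (at p within N) (X p))) \<bullet> p) *\<^sub>R p"
    (is "_ = ?R X Y") and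
    tan: "X p \<bullet> p = 0" and dY: "frechet_derivative Y (at p within N) (X p) \<bullet> p = - (Y p \<bullet> X p)"
    if fields: "vector_field N X" "vector_field N Y" for X Y
  proof -
    obtain UY Y' where Y: "open UY" "N \<subseteq> UY" "\<And>q. q \<in> N \<Longrightarrow> Y q = Y' q"
      "\<And>q. q \<in> UY \<Longrightarrow> (Y' has_derivative frechet_derivative Y' (at q)) (at q)"
      "\<And>q. q \<in> N \<Longrightarrow> Y' q \<bullet> q = 0"
      "\<And>q v. q \<in> N \<Longrightarrow> v \<bullet> q = 0 \<Longrightarrow> frechet_derivative Y (at q within N) v = frechet_derivative Y' (at q) v"
      "\<And>q v. q \<in> N \<Longrightarrow> v \<bullet> q = 0 \<Longrightarrow> frechet_derivative Y' (at q) v \<bullet> q = - (Y' q \<bullet> v)"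
      using fields(2) unfolding N_def by (rule vector_field_sphere_extension) blast
    show tan: "X p \<bullet> p = 0"
      using fields(1) p tangent_space_sphere[of p] unfolding N_def vector_field_def by blast
    then show "frechet_derivative Y (at p within N) (X p) \<bullet> p = - (Y p \<bullet> X p)"
      using Y p by simp
    let ?A = "\<lambda>q. frechet_derivative Z' (at q) (Y' q)"
    define A' where "A' = (\<lambda>x. frechet_derivative (\<lambda>q. frechet_derivative Z' (at q) (Y' p)) (at p) x
        + frechet_derivative Z' (at p) (frechet_derivative Y' (at p) x))"
    have A: "(?A has_derivative A') (at p)"
      unfolding A'_def
      by (rule has_derivative_frechet_derivative_apply[OF Z(1) _ Z(3)]) (use p Z Y in auto)
    have "((\<lambda>q. ?A q - (?A q \<bullet> q) *\<^sub>R q) has_derivative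
       (\<lambda>x. A' x - ((?A p \<bullet> p) *\<^sub>R x + (?A p \<bullet> x + A' x \<bullet> p) *\<^sub>R p))) (at p)"
      by (intro derivative_intros A has_derivative_scaleR has_derivative_inner)
    moreover have "levi_civita N Y Z q = ?A q - (?A q \<bullet> q) *\<^sub>R q" if "q \<in> N" for q
      using that Y Z by (simp add: levi_civita_def proj)
    ultimately have "frechet_derivative (levi_civita N Y Z) (at p within N) (X p)
        = A' (X p) - ((?A p \<bullet> p) *\<^sub>R X p + (?A p \<bullet> X p + A' (X p) \<bullet> p) *\<^sub>R p)"
      using p tan by (intro frechet_derivative_within_tangent)
        (auto simp: N_def tangent_space_sphere)
    moreover have "?A p \<bullet> p = - (Z p \<bullet> Y p)"
      using Z Y p by simp
    ultimately have "levi_civita N X (levi_civita N Y Z) p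
        = A' (X p) + (Z p \<bullet> Y p) *\<^sub>R X p - (A' (X p) \<bullet> p) *\<^sub>R p"
      using tan pp by (simp add: levi_civita_def proj[OF p] inner_diff_left inner_add_left
          scaleR_add_left scaleR_diff_left)
    then show "levi_civita N X (levi_civita N Y Z) p = ?R X Y"
      using Y(3)[OF p] Y(6)[OF p tan] by (simp add: A'_def)
  qed
  have sym: "frechet_derivative (\<lambda>q. frechet_derivative Z' (at q) v) (at p) w
     = frechet_derivative (\<lambda>q. frechet_derivative Z' (at q) w) (at p) v" for v w
    using symmetric_second_derivative[OF Z(1) _ Z(3)] p Z(2) by blast
  have lin: "linear (frechet_derivative Z' (at p))"
    using Z(2,5) p by (metis has_derivative_linear subsetD)
  have br: "levi_civita N (lie_bracket N X Y) Z p =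
      frechet_derivative Z' (at p) (frechet_derivative Y (at p within N) (X p))
      - frechet_derivative Z' (at p) (frechet_derivative X (at p within N) (Y p))
      - ((frechet_derivative Z' (at p) (frechet_derivative Y (at p within N) (X p))
      - frechet_derivative Z' (at p) (frechet_derivative X (at p within N) (Y p))) \<bullet> p) *\<^sub>R p"
  proof -
    \<comment> \<open>Both normal parts equal \<open>- (X p \<bullet> Y p)\<close>, so the bracket
      is tangent and \<open>Z\<close> may be differentiated along it through its extension.\<close>
    have "(frechet_derivative Y (at p within N) (X p) - frechet_derivative X (at p within N) (Y p)) \<bullet> p = 0"
      using dY[OF assms(3,4)] dY[OF assms(4,3)] by (simp add: inner_diff_left inner_commute[of "X p"])
    then show ?thesis
      by (simp add: levi_civita_def lie_bracket_def proj[OF p] Z(7)[OF p] linear_diff[OF lin])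
  qed
  show ?thesis
    unfolding *[OF assms(3,4)] *[OF assms(4,3)] br sym[of "X p" "Y p"]
    by (simp add: inner_add_left inner_diff_left inner_commute algebra_simps)
qed

lemma curvature_sphere:
  fixes p :: "'a::euclidean_space"
  assumes p: "p \<in> sphere 0 1" and "x \<bullet> p = 0" "y \<bullet> p = 0" "z \<bullet> p = 0"
  shows "curvature (sphere 0 1) p x y z = (y \<bullet> z) *\<^sub>R x - (x \<bullet> z) *\<^sub>R y"
  unfolding curvature_def
proof (rule the_equality, safe)
  fix X Y Z :: "'a \<Rightarrow> 'a"
  assume "vector_field (sphere 0 1) X" "vector_field (sphere 0 1) Y" "vector_field (sphere 0 1) Z"
  from curvature_sphere_fields[OF p this]
  show "(Y p \<bullet> Z p) *\<^sub>R X p - (X p \<bullet> Z p) *\<^sub>R Y p =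
     levi_civita (sphere 0 1) X (levi_civita (sphere 0 1) Y Z) p
       - levi_civita (sphere 0 1) Y (levi_civita (sphere 0 1) X Z) p
       - levi_civita (sphere 0 1) (lie_bracket (sphere 0 1) X Y) Z p" by simp
next
  fix w
  \<comment> \<open>These fields show that tangent extensions of \<open>x\<close>, \<open>y\<close>,
    \<open>z\<close> exist; otherwise the universal condition would not determine
    \<open>w\<close>.\<close>
  let ?F = "\<lambda>v q. v - (v \<bullet> q) *\<^sub>R q"
  assume w: "\<forall>X Y Z. vector_field (sphere 0 1) X \<and> vector_field (sphere 0 1) Y \<and>
      vector_field (sphere 0 1) Z \<and> X p = x \<and> Y p = y \<and> Z p = z \<longrightarrow>
      w = levi_civita (sphere 0 1) X (levi_civita (sphere 0 1) Y Z) p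
        - levi_civita (sphere 0 1) Y (levi_civita (sphere 0 1) X Z) p
        - levi_civita (sphere 0 1) (lie_bracket (sphere 0 1) X Y) Z p"
  have F: "vector_field (sphere 0 1) (?F v)" for v :: 'a
    by (auto simp: vector_field_def smooth_on_const_diff_proj tangent_space_sphere
        inner_diff_left dot_square_norm)
  have "?F x p = x" "?F y p = y" "?F z p = z" using assms by auto
  with w F show "w = (y \<bullet> z) *\<^sub>R x - (x \<bullet> z) *\<^sub>R y"
    using curvature_sphere_fields[OF p F F F, of x y z] by (metis (no_types, lifting))
qed

section \<open>Surfaces in the 3-sphere with a Hopf frame\<close>

definition imul :: "complex \<times> complex \<Rightarrow> complex \<times> complex" where
  "imul p = (\<i> * fst p, \<i> * snd p)"

lemma imul_imul [simp]: "imul (imul p) = - p"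
  by (simp add: imul_def prod_eq_iff flip: mult.assoc)

lemma bounded_linear_imul: "bounded_linear imul"
  unfolding imul_def linear_conv_bounded_linear[symmetric]
  by (intro linearI) (auto simp: algebra_simps)

lemmas imul_linear [simp] = bounded_linear.linear[OF bounded_linear_imul, THEN linear_add]
  bounded_linear.linear[OF bounded_linear_imul, THEN linear_diff]
  bounded_linear.linear[OF bounded_linear_imul, THEN linear_scale]
  bounded_linear.linear[OF bounded_linear_imul, THEN linear_neg]

lemmas has_derivative_imul = bounded_linear.has_derivative[OF bounded_linear_imul]

lemma inner_imul_imul [simp]: "imul p \<bullet> imul q = p \<bullet> q"
  by (simp add: imul_def inner_complex_def inner_prod_def)

lemma inner_imul_left: "imul p \<bullet> q = - (p \<bullet> imul q)"
  by (simp add: imul_def inner_complex_def inner_prod_def)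

lemma inner_imul_same [simp]: "p \<bullet> imul p = 0" "imul p \<bullet> p = 0"
  by (simp_all add: imul_def inner_complex_def inner_prod_def)

lemma pd_eqI: "(F has_derivative F') (at u) \<Longrightarrow> pd i F u = F' (axis i 1)"
  by (simp add: pd_def frechet_derivative_at[symmetric])

lemma pd_cong_open:
  assumes "open U" "u \<in> U" "\<And>v. v \<in> U \<Longrightarrow> F v = H v"
  shows "pd i F u = pd i H u"
  unfolding pd_def using frechet_derivative_cong_open[OF assms] by simp

lemma matrix_inv_eqI:
  fixes A :: "real^'n^'n"
  assumes "A ** B = mat 1"
  shows "matrix_inv A = B"
proof -
  have BA: "B ** A = mat 1" using assms by (simp add: matrix_left_right_inverse)
  have "A ** matrix_inv A = mat 1 \<and> matrix_inv A ** A = mat 1"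
    unfolding matrix_inv_def by (rule someI[of _ B]) (use assms BA in blast)
  then show ?thesis
    by (metis BA matrix_mul_assoc matrix_mul_lid matrix_mul_rid)
qed

text \<open>An immersed surface \<open>f\<close> in the 3-sphere with orthonormal tangent frame \<open>T\<close>, \<open>\<i> f\<close> and unit
  normal \<open>\<i> T\<close>; \<open>a\<close>, \<open>b\<close> is the dual coframe, and \<open>K1\<close>, \<open>K2\<close> are the successive derivatives of
  the curvature \<open>K\<close> along \<open>a\<close>.\<close>

locale hopf_frame =
  fixes U :: "(real^2) set" and f T :: "real^2 \<Rightarrow> complex \<times> complex"
    and a b :: "real^2 \<Rightarrow> real^2 \<Rightarrow> real" and K K1 K2 :: "real^2 \<Rightarrow> real"
    and G :: "real^2 \<Rightarrow> real^2^2"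
  assumes open_U: "open U" and C2: "Ck_on 2 U f"
    and df: "u \<in> U \<Longrightarrow> (f has_derivative (\<lambda>v. a u v *\<^sub>R T u + b u v *\<^sub>R imul (f u))) (at u)"
    and dT: "u \<in> U \<Longrightarrow>
      (T has_derivative (\<lambda>v. - a u v *\<^sub>R f u + (b u v + K u * a u v) *\<^sub>R imul (T u))) (at u)"
    and dK: "u \<in> U \<Longrightarrow> (K has_derivative (\<lambda>v. K1 u * a u v)) (at u)"
    and dK1: "u \<in> U \<Longrightarrow> (K1 has_derivative (\<lambda>v. K2 u * a u v)) (at u)"
    and da: "u \<in> U \<Longrightarrow> (\<lambda>u. a u v) differentiable (at u)"
    and db: "u \<in> U \<Longrightarrow> (\<lambda>u. b u v) differentiable (at u)"
    and ff: "u \<in> U \<Longrightarrow> f u \<bullet> f u = 1" and TT: "u \<in> U \<Longrightarrow> T u \<bullet> T u = 1"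
    and fT: "u \<in> U \<Longrightarrow> f u \<bullet> T u = 0" and fN: "u \<in> U \<Longrightarrow> f u \<bullet> imul (T u) = 0"
    and coframe: "u \<in> U \<Longrightarrow>
      a u (axis 1 1) * b u (axis 2 1) - a u (axis 2 1) * b u (axis 1 1) \<noteq> 0"
    and G: "u \<in> U \<Longrightarrow> G u = (\<chi> i j. pd i f u \<bullet> pd j f u)"
begin

abbreviation "a_co i u \<equiv> a u (axis i 1)"
abbreviation "b_co i u \<equiv> b u (axis i 1)"

lemma frame_inner [simp]:
  assumes "u \<in> U"
  shows "f u \<bullet> f u = 1" "T u \<bullet> T u = 1" "f u \<bullet> T u = 0" "T u \<bullet> f u = 0"
    "f u \<bullet> imul (T u) = 0" "imul (T u) \<bullet> f u = 0" "imul (f u) \<bullet> T u = 0" "T u \<bullet> imul (f u) = 0"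
  using ff[OF assms] TT[OF assms] fT[OF assms] fN[OF assms]
    inner_commute[of "T u" "f u"] inner_commute[of "imul (T u)" "f u"]
    inner_imul_left[of "f u" "T u"] inner_commute[of "T u" "imul (f u)"]
  by simp_all

lemma in_sphere: "u \<in> U \<Longrightarrow> f u \<in> sphere 0 1"
  using ff by (simp add: norm_eq_sqrt_inner)

lemma pd_f: "u \<in> U \<Longrightarrow> pd i f u = a_co i u *\<^sub>R T u + b_co i u *\<^sub>R imul (f u)"
  by (rule pd_eqI[OF df])

lemma cov_f: "u \<in> U \<Longrightarrow> cov S3 f i V u = pd i V u - (pd i V u \<bullet> f u) *\<^sub>R f u"
  by (simp add: cov_def orth_proj_sphere[OF in_sphere])

section \<open>Inverse metric, traces and Christoffel symbols in the frame\<close>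

text \<open>By Cramer's rule these are the coordinates of the vector that the derivative of
  \<open>f\<close> sends to \<open>T u\<close>; \<open>dual_b\<close> belongs to the vector sent to
  \<open>imul (f u)\<close>.\<close>

definition dual_a :: "real^2 \<Rightarrow> 2 \<Rightarrow> real" where
  "dual_a u i = (if i = 1 then b_co 2 u else - b_co 1 u) / (a_co 1 u * b_co 2 u - a_co 2 u * b_co 1 u)"

definition dual_b :: "real^2 \<Rightarrow> 2 \<Rightarrow> real" where
  "dual_b u i = (if i = 1 then - a_co 2 u else a_co 1 u) / (a_co 1 u * b_co 2 u - a_co 2 u * b_co 1 u)"

lemma dual_frame:
  assumes "u \<in> U"
  shows "dual_a u 1 * a_co 1 u + dual_a u 2 * a_co 2 u = 1"
    "dual_a u 1 * b_co 1 u + dual_a u 2 * b_co 2 u = 0"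
    "dual_b u 1 * a_co 1 u + dual_b u 2 * a_co 2 u = 0"
    "dual_b u 1 * b_co 1 u + dual_b u 2 * b_co 2 u = 1"
  using coframe[OF assms] by (simp_all add: dual_a_def dual_b_def divide_simps)

lemma dual_frame':
  assumes "u \<in> U"
  shows "a_co 1 u * dual_a u 1 + b_co 1 u * dual_b u 1 = 1"
    "a_co 1 u * dual_a u 2 + b_co 1 u * dual_b u 2 = 0"
    "a_co 2 u * dual_a u 1 + b_co 2 u * dual_b u 1 = 0"
    "a_co 2 u * dual_a u 2 + b_co 2 u * dual_b u 2 = 1"
  using coframe[OF assms] by (simp_all add: dual_a_def dual_b_def divide_simps)

lemma matrix_inv_G:
  assumes "u \<in> U"
  shows "matrix_inv (G u) $ i $ j = dual_a u i * dual_a u j + dual_b u i * dual_b u j"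
proof -
  have g: "G u $ i $ j = a_co i u * a_co j u + b_co i u * b_co j u" for i j
    using assms by (simp add: G pd_f inner_add_left inner_add_right)
  let ?H = "\<chi> i j. dual_a u i * dual_a u j + dual_b u i * dual_b u j"
  have "(\<Sum>k\<in>UNIV. G u $ i $ k * ?H $ k $ j) = a_co i u * dual_a u j + b_co i u * dual_b u j" for i j
  proof -
    have "(\<Sum>k\<in>UNIV. G u $ i $ k * ?H $ k $ j) =
       a_co i u * (dual_a u 1 * a_co 1 u + dual_a u 2 * a_co 2 u) * dual_a u j
       + a_co i u * (dual_b u 1 * a_co 1 u + dual_b u 2 * a_co 2 u) * dual_b u j
       + b_co i u * (dual_a u 1 * b_co 1 u + dual_a u 2 * b_co 2 u) * dual_a u j
       + b_co i u * (dual_b u 1 * b_co 1 u + dual_b u 2 * b_co 2 u) * dual_b u j"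
      by (simp add: sum_2 g algebra_simps)
    then show ?thesis by (simp add: dual_frame[OF assms])
  qed
  then have "G u ** ?H = mat 1"
    by (simp add: matrix_matrix_mult_def mat_def vec_eq_iff forall_2 dual_frame'[OF assms])
  from matrix_inv_eqI[OF this] show ?thesis by simp
qed

text \<open>The coframe is orthonormal, so a trace adds up the diagonal components and the mixed
  ones \<open>Y\<close> and \<open>Z\<close> drop out.\<close>

lemma metric_trace_coframe:
  assumes "u \<in> U"
  shows "metric_trace G (\<lambda>i j. a_co i u *\<^sub>R a_co j u *\<^sub>R X + b_co i u *\<^sub>R a_co j u *\<^sub>R Y
      + a_co i u *\<^sub>R b_co j u *\<^sub>R Z + b_co i u *\<^sub>R b_co j u *\<^sub>R W) u = X + W"
proof -
  let ?m = "\<lambda>c d. c 1 * d 1 u + c 2 * d 2 u"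
  have "metric_trace G (\<lambda>i j. a_co i u *\<^sub>R a_co j u *\<^sub>R X + b_co i u *\<^sub>R a_co j u *\<^sub>R Y
      + a_co i u *\<^sub>R b_co j u *\<^sub>R Z + b_co i u *\<^sub>R b_co j u *\<^sub>R W) u =
     (?m (dual_a u) a_co *\<^sub>R ?m (dual_a u) a_co *\<^sub>R X + ?m (dual_b u) a_co *\<^sub>R ?m (dual_b u) a_co *\<^sub>R X)
     + (?m (dual_a u) b_co *\<^sub>R ?m (dual_a u) a_co *\<^sub>R Y + ?m (dual_b u) b_co *\<^sub>R ?m (dual_b u) a_co *\<^sub>R Y)
     + (?m (dual_a u) a_co *\<^sub>R ?m (dual_a u) b_co *\<^sub>R Z + ?m (dual_b u) a_co *\<^sub>R ?m (dual_b u) b_co *\<^sub>R Z)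
     + (?m (dual_a u) b_co *\<^sub>R ?m (dual_a u) b_co *\<^sub>R W + ?m (dual_b u) b_co *\<^sub>R ?m (dual_b u) b_co *\<^sub>R W)"
    by (simp only: metric_trace_def sum_2 matrix_inv_G[OF assms] scaleR_add_left scaleR_add_right
        scaleR_scaleR add_ac mult_ac distrib_left distrib_right)
  then show ?thesis by (simp only: dual_frame[OF assms]) simp
qed

lemma pd_pd_f_symmetric: "u \<in> U \<Longrightarrow> pd i (pd j f) u = pd j (pd i f) u"
  unfolding pd_def[abs_def] by (rule symmetric_second_derivative[OF open_U _ C2])

text \<open>For a metric induced from a Euclidean space, symmetry of second derivatives lets all but
  one inner product cancel in the sum of the three metric derivatives.\<close>

lemma christoffel_G:
  assumes "u \<in> U"
  shows "christoffel G k i j u = (\<Sum>l\<in>UNIV. matrix_inv (G u) $ k $ l * (pd i (pd j f) u \<bullet> pd l f u))"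
proof -
  have D: "(pd j f has_derivative frechet_derivative (pd j f) (at u)) (at u)" for j
    using C2 assms by (simp add: numeral_2_eq_2 pd_def[abs_def] flip: frechet_derivative_works)
  have "pd i (\<lambda>v. G v $ j $ l) u = pd i (pd j f) u \<bullet> pd l f u + pd j f u \<bullet> pd i (pd l f) u" for i j l
  proof -
    have "pd i (\<lambda>v. G v $ j $ l) u = pd i (\<lambda>v. pd j f v \<bullet> pd l f v) u"
      by (rule pd_cong_open[OF open_U assms]) (simp add: G)
    also have "\<dots> = pd j f u \<bullet> pd i (pd l f) u + pd i (pd j f) u \<bullet> pd l f u"
      unfolding pd_eqI[OF has_derivative_inner[OF D D]] by (simp add: pd_def)
    finally show ?thesis by simp
  qed
  note pd_G = this
  have "pd i (\<lambda>v. G v $ j $ l) u + pd j (\<lambda>v. G v $ i $ l) u - pd l (\<lambda>v. G v $ i $ j) u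
      = 2 * (pd i (pd j f) u \<bullet> pd l f u)" for l
    unfolding pd_G
    using pd_pd_f_symmetric[OF assms, of i j] pd_pd_f_symmetric[OF assms, of i l]
      pd_pd_f_symmetric[OF assms, of j l]
    by (simp add: inner_commute)
  then show ?thesis
    by (simp add: christoffel_def sum_distrib_left)
qed

text \<open>The Christoffel symbols are the coordinates of the tangential part of
  \<open>pd i (pd j f) u\<close>, so contraction with \<open>a\<close> and \<open>b\<close> reads
  off its frame components. \<open>P\<close> and \<open>Q\<close> are general because the derivative
  of the tension field is treated like that of \<open>f\<close>.\<close>

lemma christoffel_coframe:
  fixes P Q :: "'c::real_vector"
  assumes "u \<in> U"
  shows "(\<Sum>k\<in>UNIV. christoffel G k i j u *\<^sub>R (a_co k u *\<^sub>R P + b_co k u *\<^sub>R Q))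
     = (pd i (pd j f) u \<bullet> T u) *\<^sub>R P + (pd i (pd j f) u \<bullet> imul (f u)) *\<^sub>R Q"
proof -
  let ?m = "\<lambda>c d. c 1 * d 1 u + c 2 * d 2 u"
  define x y where "x = pd i (pd j f) u \<bullet> T u" and "y = pd i (pd j f) u \<bullet> imul (f u)"
  have c: "christoffel G k i j u =
     dual_a u k * (?m (dual_a u) a_co * x + ?m (dual_a u) b_co * y)
     + dual_b u k * (?m (dual_b u) a_co * x + ?m (dual_b u) b_co * y)" for k
    unfolding christoffel_G[OF assms]
    by (simp add: sum_2 matrix_inv_G[OF assms] pd_f[OF assms] inner_add_right x_def y_def) algebra
  have "christoffel G k i j u = dual_a u k * x + dual_b u k * y" for k
    unfolding c by (simp only: dual_frame[OF assms]) simp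
  note c' = this
  have "(\<Sum>k\<in>UNIV. christoffel G k i j u *\<^sub>R (a_co k u *\<^sub>R P + b_co k u *\<^sub>R Q))
     = (?m (dual_a u) a_co * x + ?m (dual_b u) a_co * y) *\<^sub>R P
       + (?m (dual_a u) b_co * x + ?m (dual_b u) b_co * y) *\<^sub>R Q"
    by (simp only: c' sum_2 scaleR_add_left scaleR_add_right scaleR_scaleR add_ac mult_ac
        distrib_left distrib_right)
  then show ?thesis by (simp only: dual_frame[OF assms]) (simp add: x_def y_def)
qed

lemma pd_coframe:
  assumes u: "u \<in> U" and V: "\<And>v. v \<in> U \<Longrightarrow> V v = a_co j v *\<^sub>R P v + b_co j v *\<^sub>R Q v"
    and P: "(P has_derivative (\<lambda>v. a u v *\<^sub>R Pa + b u v *\<^sub>R Pb)) (at u)"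
    and Q: "(Q has_derivative (\<lambda>v. a u v *\<^sub>R Qa + b u v *\<^sub>R Qb)) (at u)"
  shows "pd i V u = pd i (a_co j) u *\<^sub>R P u + pd i (b_co j) u *\<^sub>R Q u
      + (a_co i u *\<^sub>R a_co j u *\<^sub>R Pa + b_co i u *\<^sub>R a_co j u *\<^sub>R Pb
      + a_co i u *\<^sub>R b_co j u *\<^sub>R Qa + b_co i u *\<^sub>R b_co j u *\<^sub>R Qb)"
proof -
  have "((\<lambda>v. a_co j v *\<^sub>R P v + b_co j v *\<^sub>R Q v) has_derivative
    (\<lambda>v. (a_co j u *\<^sub>R (a u v *\<^sub>R Pa + b u v *\<^sub>R Pb) + frechet_derivative (a_co j) (at u) v *\<^sub>R P u)
       + (b_co j u *\<^sub>R (a u v *\<^sub>R Qa + b u v *\<^sub>R Qb) + frechet_derivative (b_co j) (at u) v *\<^sub>R Q u))) (at u)"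
    by (intro derivative_intros has_derivative_scaleR P Q)
      (use da[OF u] db[OF u] in \<open>simp_all flip: frechet_derivative_works\<close>)
  from pd_eqI[OF this] pd_cong_open[OF open_U u V]
  show ?thesis by (simp add: pd_def algebra_simps)
qed

lemma
  assumes u: "u \<in> U"
  shows dT': "(T has_derivative
      (\<lambda>v. a u v *\<^sub>R (K u *\<^sub>R imul (T u) - f u) + b u v *\<^sub>R imul (T u))) (at u)"
    and dif': "((\<lambda>u. imul (f u)) has_derivative
      (\<lambda>v. a u v *\<^sub>R imul (T u) + b u v *\<^sub>R - f u)) (at u)"
  by (rule has_derivative_eq_rhs[OF dT[OF u]], force simp: algebra_simps)
    (rule has_derivative_eq_rhs[OF has_derivative_imul[OF df[OF u]]], auto)

lemmas pd_pd_f = pd_coframe[OF _ pd_f dT' dif']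

text \<open>The derivatives of \<open>T\<close> and \<open>\<i> f\<close> have no tangential
  component, that is, both fields are parallel on the surface. So only derivatives of the
  coefficients contribute; this is where flatness shows.\<close>

lemma pd_pd_f_inner:
  assumes u: "u \<in> U"
  shows "pd i (pd j f) u \<bullet> T u = pd i (a_co j) u" "pd i (pd j f) u \<bullet> imul (f u) = pd i (b_co j) u"
  using u by (simp_all add: pd_pd_f[OF u _ u u] inner_add_left inner_diff_left)

text \<open>By \<open>pd_pd_f_inner\<close> the Christoffel terms subtract exactly the derivatives
  of the coefficients, which leaves a bilinear form in the coframe. Tangency of \<open>P\<close> and
  \<open>Q\<close> to the sphere keeps the projection from changing the cancelling terms.\<close>

lemma cov_coframe:
  assumes u: "u \<in> U" and V: "\<And>j v. v \<in> U \<Longrightarrow> V j v = a_co j v *\<^sub>R P v + b_co j v *\<^sub>R Q v"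
    and P: "(P has_derivative (\<lambda>v. a u v *\<^sub>R Pa + b u v *\<^sub>R Pb)) (at u)"
    and Q: "(Q has_derivative (\<lambda>v. a u v *\<^sub>R Qa + b u v *\<^sub>R Qb)) (at u)"
    and "P u \<bullet> f u = 0" "Q u \<bullet> f u = 0"
  shows "cov S3 f i (V j) u - (\<Sum>k\<in>UNIV. christoffel G k i j u *\<^sub>R V k u)
     = a_co i u *\<^sub>R a_co j u *\<^sub>R (Pa - (Pa \<bullet> f u) *\<^sub>R f u) + b_co i u *\<^sub>R a_co j u *\<^sub>R (Pb - (Pb \<bullet> f u) *\<^sub>R f u)
      + a_co i u *\<^sub>R b_co j u *\<^sub>R (Qa - (Qa \<bullet> f u) *\<^sub>R f u) + b_co i u *\<^sub>R b_co j u *\<^sub>R (Qb - (Qb \<bullet> f u) *\<^sub>R f u)"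
proof -
  have "pd i (V j) u = pd i (a_co j) u *\<^sub>R P u + pd i (b_co j) u *\<^sub>R Q u
      + (a_co i u *\<^sub>R a_co j u *\<^sub>R Pa + b_co i u *\<^sub>R a_co j u *\<^sub>R Pb
      + a_co i u *\<^sub>R b_co j u *\<^sub>R Qa + b_co i u *\<^sub>R b_co j u *\<^sub>R Qb)"
    by (rule pd_coframe[OF u V P Q])
  then show ?thesis
    unfolding V[OF u] christoffel_coframe[OF u] pd_pd_f_inner[OF u] cov_f[OF u]
    using assms(5,6) by (simp add: inner_add_left algebra_simps)
qed

text \<open>The zero coefficient expresses that the fibres are geodesics. The mixed coefficient 1
  comes from the twisting of the Hopf fibration and is invisible to the trace.\<close>

lemma second_fundamental_form:
  assumes u: "u \<in> U"
  shows "cov S3 f i (pd j f) u - (\<Sum>k\<in>UNIV. christoffel G k i j u *\<^sub>R pd k f u)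
     = a_co i u *\<^sub>R a_co j u *\<^sub>R (K u *\<^sub>R imul (T u)) + b_co i u *\<^sub>R a_co j u *\<^sub>R imul (T u)
      + a_co i u *\<^sub>R b_co j u *\<^sub>R imul (T u) + b_co i u *\<^sub>R b_co j u *\<^sub>R 0"
  using u by (subst cov_coframe[OF u pd_f dT'[OF u] dif'[OF u]]) (simp_all add: inner_diff_left)

section \<open>Tension, mean curvature and bitension\<close>

lemma tension_eq:
  assumes u: "u \<in> U"
  shows "tension S3 G f u = K u *\<^sub>R imul (T u)"
  unfolding tension_def second_fundamental_form[OF u] metric_trace_coframe[OF u] by simp

lemma mean_curvature_eq:
  assumes u: "u \<in> U"
  shows "mean_curvature S3 G f u = (K u / 2) *\<^sub>R imul (T u)"
proof -
  have D: "frechet_derivative f (at u) = (\<lambda>v. a u v *\<^sub>R T u + b u v *\<^sub>R imul (f u))"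
    using frechet_derivative_at[OF df[OF u]] by simp
  have lin: "linear (frechet_derivative f (at u))"
    using df[OF u] D has_derivative_linear by metis
  \<comment> \<open>The second fundamental form is a multiple of the normal
    \<open>imul (T u)\<close>, so the Christoffel term is the whole tangential part, and the mean
    curvature is half the tension field.\<close>
  have proj: "orth_proj (range (frechet_derivative f (at u))) (cov S3 f i (pd j f) u)
      = (\<Sum>k\<in>UNIV. christoffel G k i j u *\<^sub>R pd k f u)" for i j
  proof (rule orth_proj_eqI)
    show "subspace (range (frechet_derivative f (at u)))"
      by (rule linear_subspace_image[OF lin subspace_UNIV])
    then show "(\<Sum>k\<in>UNIV. christoffel G k i j u *\<^sub>R pd k f u) \<in> range (frechet_derivative f (at u))"
      by (intro subspace_sum subspace_scale) (auto simp: pd_def)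
    show "orthogonal (cov S3 f i (pd j f) u - (\<Sum>k\<in>UNIV. christoffel G k i j u *\<^sub>R pd k f u)) z"
      if "z \<in> range (frechet_derivative f (at u))" for z
      using that u
      by (auto simp: second_fundamental_form D orthogonal_def inner_add_left inner_add_right)
  qed
  show ?thesis
    using tension_eq[OF u] by (simp add: mean_curvature_def proj tension_def)
qed

lemma bitension_eq:
  assumes u: "u \<in> U"
  shows "bitension S3 G f u = (K2 u - K u ^ 3) *\<^sub>R imul (T u) - (2 * K1 u) *\<^sub>R imul (f u)
     - (3 * K u * K1 u) *\<^sub>R T u"
proof -
  \<comment> \<open>\<open>P\<close> and \<open>Q\<close> are the covariant derivatives of the
    tension field along \<open>T\<close> and along the fibre.\<close>
  define P where "P = (\<lambda>v. K1 v *\<^sub>R imul (T v) - K v *\<^sub>R imul (f v) - (K v)\<^sup>2 *\<^sub>R T v)"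
  define Q where "Q = (\<lambda>v. - K v *\<^sub>R T v)"
  have V: "cov S3 f j (tension S3 G f) v = a_co j v *\<^sub>R P v + b_co j v *\<^sub>R Q v" if v: "v \<in> U" for j v
  proof -
    have "pd j (tension S3 G f) v = pd j (\<lambda>u. K u *\<^sub>R imul (T u)) v"
      by (rule pd_cong_open[OF open_U v tension_eq])
    also have "\<dots> = K v *\<^sub>R imul (- a_co j v *\<^sub>R f v + (b_co j v + K v * a_co j v) *\<^sub>R imul (T v))
        + (K1 v * a_co j v) *\<^sub>R imul (T v)"
      by (rule pd_eqI[OF has_derivative_scaleR[OF dK[OF v] has_derivative_imul[OF dT[OF v]]]])
    finally have pd: "pd j (tension S3 G f) v = K v *\<^sub>R imul (- a_co j v *\<^sub>R f v + (b_co j v + K v * a_co j v) *\<^sub>R imul (T v))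
        + (K1 v * a_co j v) *\<^sub>R imul (T v)" .
    show ?thesis
      unfolding cov_f[OF v] pd
      using v by (simp add: P_def Q_def inner_add_left inner_diff_left
          power2_eq_square algebra_simps)
  qed
  \<comment> \<open>The components of the derivatives of \<open>P\<close> and \<open>Q\<close> along
    the coframe; the trace retains only \<open>Pa\<close> and \<open>Qb\<close>.\<close>
  define Pa where "Pa = (K2 u - K u - K u ^ 3) *\<^sub>R imul (T u) - K1 u *\<^sub>R imul (f u) - K1 u *\<^sub>R imul (f u)
     - (K u * K1 u) *\<^sub>R T u - (2 * (K u * K1 u)) *\<^sub>R T u + (K u)\<^sup>2 *\<^sub>R f u"
  define Pb where "Pb = K u *\<^sub>R f u - K1 u *\<^sub>R T u - (K u)\<^sup>2 *\<^sub>R imul (T u)"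
  define Qa where "Qa = K u *\<^sub>R f u - K1 u *\<^sub>R T u - (K u)\<^sup>2 *\<^sub>R imul (T u)"
  define Qb where "Qb = - K u *\<^sub>R imul (T u)"
  note dN = has_derivative_imul[OF dT[OF u]] and dif = has_derivative_imul[OF df[OF u]]
  have "(P has_derivative (\<lambda>v. K1 u *\<^sub>R imul (- a u v *\<^sub>R f u + (b u v + K u * a u v) *\<^sub>R imul (T u))
      + (K2 u * a u v) *\<^sub>R imul (T u)
      - (K u *\<^sub>R imul (a u v *\<^sub>R T u + b u v *\<^sub>R imul (f u)) + (K1 u * a u v) *\<^sub>R imul (f u))
      - ((K u)\<^sup>2 *\<^sub>R (- a u v *\<^sub>R f u + (b u v + K u * a u v) *\<^sub>R imul (T u))
         + (K u * (K1 u * a u v) + (K1 u * a u v) * K u) *\<^sub>R T u))) (at u)"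
    unfolding P_def power2_eq_square
    by (intro derivative_intros has_derivative_scaleR has_derivative_mult dN dif dT dK dK1 u)
  then have P: "(P has_derivative (\<lambda>v. a u v *\<^sub>R Pa + b u v *\<^sub>R Pb)) (at u)"
    by (rule has_derivative_eq_rhs)
      (auto simp: Pa_def Pb_def algebra_simps power2_eq_square power3_eq_cube)
  have "(Q has_derivative (\<lambda>v. - K u *\<^sub>R (- a u v *\<^sub>R f u + (b u v + K u * a u v) *\<^sub>R imul (T u))
      + - (K1 u * a u v) *\<^sub>R T u)) (at u)"
    unfolding Q_def by (intro has_derivative_scaleR has_derivative_minus dT dK u)
  then have Q: "(Q has_derivative (\<lambda>v. a u v *\<^sub>R Qa + b u v *\<^sub>R Qb)) (at u)"
    by (rule has_derivative_eq_rhs) (auto simp: Qa_def Qb_def algebra_simps power2_eq_square)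
  \<comment> \<open>The tension field is normal to the surface, so the curvature leaves only minus
    the metric times it. Subtracting the trace cancels the multiples \<open>- K u\<close> of the
    normal in \<open>Pa\<close> and \<open>Qb\<close>.\<close>
  have "curvature S3 (f u) (pd i f u) (tension S3 G f u) (pd j f u)
     = a_co i u *\<^sub>R a_co j u *\<^sub>R (- K u *\<^sub>R imul (T u)) + b_co i u *\<^sub>R a_co j u *\<^sub>R 0
      + a_co i u *\<^sub>R b_co j u *\<^sub>R 0 + b_co i u *\<^sub>R b_co j u *\<^sub>R (- K u *\<^sub>R imul (T u))" for i j
    using u by (subst curvature_sphere[OF in_sphere[OF u]])
      (simp_all add: tension_eq pd_f inner_add_left inner_add_right algebra_simps)
  then have curv: "metric_trace G (\<lambda>i j. curvature S3 (f u) (pd i f u) (tension S3 G f u) (pd j f u)) u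
     = - K u *\<^sub>R imul (T u) + - K u *\<^sub>R imul (T u)"
    by (simp only: metric_trace_coframe[OF u])
  have "P u \<bullet> f u = 0" "Q u \<bullet> f u = 0"
    using u by (simp_all add: P_def Q_def inner_diff_left)
  then have "bitension S3 G f u = Pa - (Pa \<bullet> f u) *\<^sub>R f u + (Qb - (Qb \<bullet> f u) *\<^sub>R f u)
      + K u *\<^sub>R imul (T u) + K u *\<^sub>R imul (T u)"
    using cov_coframe[where V = "\<lambda>j. cov S3 f j (tension S3 G f)", OF u V P Q]
    unfolding bitension_def curv by (simp only: metric_trace_coframe[OF u]) simp
  also have "\<dots> = (K2 u - K u ^ 3) *\<^sub>R imul (T u) - K1 u *\<^sub>R imul (f u) - K1 u *\<^sub>R imul (f u)
     - (K u * K1 u) *\<^sub>R T u - (2 * (K u * K1 u)) *\<^sub>R T u"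
    using u by (simp add: Pa_def Qb_def inner_add_left inner_diff_left algebra_simps)
  also have "\<dots> = (K2 u - K u ^ 3) *\<^sub>R imul (T u) - (K1 u + K1 u) *\<^sub>R imul (f u)
     - (K u * K1 u + 2 * (K u * K1 u)) *\<^sub>R T u"
    unfolding scaleR_add_left by simp
  finally show ?thesis by simp
qed

lemma minimal_if_biharmonic:
  assumes bi: "\<And>u. u \<in> U \<Longrightarrow> bitension S3 G f u = 0" and u: "u \<in> U"
  shows "mean_curvature S3 G f u = 0"
proof -
  have K1: "K1 v = 0" if v: "v \<in> U" for v
  proof -
    have "bitension S3 G f v \<bullet> imul (f v) = - 2 * K1 v"
      using v by (simp add: bitension_eq inner_diff_left)
    then show ?thesis using bi[OF v] by simp
  qed
  \<comment> \<open>\<open>K1\<close> vanishes on all of the open set \<open>U\<close>, so its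
    derivative does too; \<open>a\<close> is nonzero by nondegeneracy of the coframe, which leaves
    \<open>K2 u = 0\<close>.\<close>
  have "(K1 has_derivative (\<lambda>v. 0)) (at u)"
    by (rule has_derivative_transform_within_open[OF has_derivative_const open_U u]) (simp add: K1)
  from has_derivative_unique[OF dK1[OF u] this] have "K2 u * a u v = 0" for v
    by meson
  moreover have "a_co 1 u \<noteq> 0 \<or> a_co 2 u \<noteq> 0" using coframe[OF u] by auto
  ultimately have "K2 u = 0" by auto
  moreover have "bitension S3 G f u \<bullet> imul (T u) = K2 u - K u ^ 3"
    using u by (simp add: bitension_eq inner_diff_left)
  ultimately have "K u = 0" using bi[OF u] by simp
  then show ?thesis by (simp add: mean_curvature_eq[OF u])
qed

end

section \<open>Horizontal lifts\<close>

definition cmul :: "complex \<Rightarrow> complex \<times> complex \<Rightarrow> complex \<times> complex" where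
  "cmul c p = (c * fst p, c * snd p)"

text \<open>\<open>p\<close> and \<open>pstar p\<close> form a unitary basis; the horizontal space at \<open>p\<close> is \<open>\<complex> pstar p\<close>.\<close>

definition pstar :: "complex \<times> complex \<Rightarrow> complex \<times> complex" where
  "pstar p = (- cnj (snd p), cnj (fst p))"

text \<open>The horizontal lift of \<open>x\<close> to \<open>p\<close> is \<open>lift_coeff p x\<close> times \<open>pstar p\<close>; the formula
  inverts the derivative of the Hopf map on the horizontal space.\<close>

definition lift_coeff :: "complex \<times> complex \<Rightarrow> complex \<times> real \<Rightarrow> complex" where
  "lift_coeff p x = (fst p)\<^sup>2 * cnj (fst x) - (snd p)\<^sup>2 * fst x - 2 * fst p * snd p * of_real (snd x)"

text \<open>Twice the scalar triple product in \<open>\<complex> \<times> \<real>\<close>; the sphere has radius \<open>1/2\<close>, so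
  \<open>triple \<alpha> \<alpha>' \<alpha>''\<close> is the geodesic curvature of \<open>\<alpha>\<close> up to orientation.\<close>

definition triple :: "complex \<times> real \<Rightarrow> complex \<times> real \<Rightarrow> complex \<times> real \<Rightarrow> real" where
  "triple A X Y = 2 * (snd A * Im (fst X * cnj (fst Y)) - snd Y * Im (cnj (fst A) * fst X)
     + snd X * Im (cnj (fst A) * fst Y))"

lemma triple_same [simp]: "triple A X X = 0" "triple A A X = 0"
  by (simp_all add: triple_def algebra_simps)

lemma has_vector_derivative_Re_Im_fst_snd:
  assumes "(g has_vector_derivative g') (at (s::real))"
  shows "((\<lambda>s. Re (fst (g s))) has_real_derivative Re (fst g')) (at s)"
    "((\<lambda>s. Im (fst (g s))) has_real_derivative Im (fst g')) (at s)"
    "((\<lambda>s. snd (g s)) has_real_derivative snd g') (at s)"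
proof -
  have *: "((\<lambda>s. L (g s)) has_real_derivative L g') (at s)" if "bounded_linear L" for L :: "complex \<times> real \<Rightarrow> real"
    using bounded_linear.has_vector_derivative[OF that assms]
    by (simp add: has_real_derivative_iff_has_vector_derivative)
  show "((\<lambda>s. Re (fst (g s))) has_real_derivative Re (fst g')) (at s)"
    "((\<lambda>s. Im (fst (g s))) has_real_derivative Im (fst g')) (at s)"
    "((\<lambda>s. snd (g s)) has_real_derivative snd g') (at s)"
    by (rule *, intro bounded_linear_compose[OF bounded_linear_Re] bounded_linear_compose[OF bounded_linear_Im]
        bounded_linear_fst bounded_linear_snd)+
qed

lemma triple_has_real_derivative:
  assumes "(A has_vector_derivative A') (at s)" "(X has_vector_derivative X') (at s)"
    "(Y has_vector_derivative Y') (at s)"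
  shows "((\<lambda>s. triple (A s) (X s) (Y s)) has_real_derivative
     triple A' (X s) (Y s) + triple (A s) X' (Y s) + triple (A s) (X s) Y') (at s)"
proof -
  note D = has_vector_derivative_Re_Im_fst_snd[OF assms(1)]
    has_vector_derivative_Re_Im_fst_snd[OF assms(2)] has_vector_derivative_Re_Im_fst_snd[OF assms(3)]
  have eq: "triple A X Y = 2 * (snd A * (Im (fst X) * Re (fst Y) - Re (fst X) * Im (fst Y))
     - snd Y * (Re (fst A) * Im (fst X) - Im (fst A) * Re (fst X))
     + snd X * (Re (fst A) * Im (fst Y) - Im (fst A) * Re (fst Y)))" for A X Y
    by (simp add: triple_def)
  show ?thesis
    unfolding eq by (rule DERIV_cong, (rule derivative_intros D)+) (simp add: algebra_simps)
qed

section \<open>Isometry and derivative of the horizontal lift\<close>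

lemma S3_iff: "p \<in> S3 \<longleftrightarrow> (Re (fst p))\<^sup>2 + (Im (fst p))\<^sup>2 + (Re (snd p))\<^sup>2 + (Im (snd p))\<^sup>2 = 1"
  by (simp add: norm_prod_def cmod_power2 add.assoc)

lemma hopf_inner:
  "2 * (hopf p \<bullet> x) = 2 * Re (fst p * cnj (snd p) * cnj (fst x))
     + snd x * ((cmod (fst p))\<^sup>2 - (cmod (snd p))\<^sup>2)"
  by (simp add: hopf_def inner_prod_def inner_complex_def field_simps)

text \<open>On vectors tangent to the 2-sphere the real part is the metric and the imaginary part,
  up to sign, the area form. The factor 4 occurs because the unit normal of a sphere of radius 1/2
  is twice \<open>hopf p\<close>.\<close>

lemma lift_coeff_product:
  assumes "p \<in> S3"
  shows "cnj (lift_coeff p x) * lift_coeff p y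
     = Complex (x \<bullet> y - 4 * (hopf p \<bullet> x) * (hopf p \<bullet> y)) (triple (hopf p) x y)"
proof -
  obtain z1 z2 w1 w2 where p: "p = (Complex z1 z2, Complex w1 w2)"
    by (metis complex.collapse prod.collapse)
  obtain x1 x2 x3 y1 y2 y3 where xy: "x = (Complex x1 x2, x3)" "y = (Complex y1 y2, y3)"
    by (metis complex.collapse prod.collapse)
  let ?n = "z1\<^sup>2 + z2\<^sup>2 + w1\<^sup>2 + w2\<^sup>2"
  have n: "?n = 1" using assms unfolding S3_iff p by simp
  \<comment> \<open>The powers of \<open>?n\<close> make both sides homogeneous of degree 4 in
    \<open>p\<close>, so these are polynomial identities without a constraint.\<close>
  have "Re (cnj (lift_coeff p x) * lift_coeff p y) = (x \<bullet> y) * ?n\<^sup>2 - (2 * (hopf p \<bullet> x)) * (2 * (hopf p \<bullet> y))"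
    unfolding lift_coeff_def hopf_inner p xy cmod_power2
    by (simp add: inner_prod_def inner_complex_def power2_eq_square algebra_simps)
  moreover have "Im (cnj (lift_coeff p x) * lift_coeff p y) = triple (hopf p) x y * ?n"
    unfolding lift_coeff_def triple_def hopf_def p xy cmod_power2
    by (simp add: power2_eq_square field_simps)
  ultimately show ?thesis by (simp add: complex_eq_iff n)
qed

definition dhopf :: "complex \<times> complex \<Rightarrow> complex \<times> complex \<Rightarrow> complex \<times> real" where
  "dhopf p v = (fst v * cnj (snd p) + fst p * cnj (snd v), fst p \<bullet> fst v - snd p \<bullet> snd v)"

text \<open>In the unitary basis \<open>p\<close>, \<open>pstar p\<close> the horizontal coefficient
  of \<open>v\<close> is the determinant \<open>snd v * fst p - fst v * snd p\<close>, and
  \<open>lift_coeff\<close> recovers it from the projected vector.\<close>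

lemma lift_coeff_dhopf:
  assumes "p \<in> S3" "v \<bullet> p = 0"
  shows "v = cmul (lift_coeff p (dhopf p v)) (pstar p) + (v \<bullet> imul p) *\<^sub>R imul p"
proof -
  obtain z1 z2 w1 w2 where p: "p = (Complex z1 z2, Complex w1 w2)"
    by (metis complex.collapse prod.collapse)
  obtain a1 a2 b1 b2 where v: "v = (Complex a1 a2, Complex b1 b2)"
    by (metis complex.collapse prod.collapse)
  let ?n = "z1\<^sup>2 + z2\<^sup>2 + w1\<^sup>2 + w2\<^sup>2"
  have n: "?n = 1" using assms(1) unfolding S3_iff p by simp
  have "lift_coeff p (dhopf p v) = of_real ?n * (snd v * fst p - fst v * snd p)"
    unfolding lift_coeff_def dhopf_def p v
    by (simp add: complex_eq_iff inner_complex_def power2_eq_square algebra_simps)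
  then have 1: "lift_coeff p (dhopf p v) = snd v * fst p - fst v * snd p" by (simp only: n) simp
  have "?n *\<^sub>R v = cmul (snd v * fst p - fst v * snd p) (pstar p) + (v \<bullet> imul p) *\<^sub>R imul p + (v \<bullet> p) *\<^sub>R p"
    unfolding cmul_def pstar_def imul_def p v
    by (simp add: complex_eq_iff inner_complex_def inner_prod_def power2_eq_square algebra_simps)
  then show ?thesis by (simp add: 1 n assms(2))
qed

text \<open>Along the fibre \<open>lift_coeff\<close>, being quadratic in the point, turns at twice
  the speed \<open>b\<close> and \<open>pstar\<close> turns back at speed \<open>b\<close>, which
  leaves \<open>b\<close>. Along the curve the phase turns by the geodesic curvature, and the change
  of \<open>pstar\<close> gives the term in \<open>p u\<close>.\<close>

lemma has_derivative_lift:
  assumes p: "p u \<in> S3" and x: "hopf (p u) \<bullet> x u = 0" "x u \<bullet> y = 0" "x u \<bullet> x u = 1"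
    and dp: "(p has_derivative (\<lambda>v. a v *\<^sub>R cmul (lift_coeff (p u) (x u)) (pstar (p u)) + b v *\<^sub>R imul (p u))) (at u)"
    and dx: "(x has_derivative (\<lambda>v. a v *\<^sub>R y)) (at u)"
  shows "((\<lambda>u. cmul (lift_coeff (p u) (x u)) (pstar (p u))) has_derivative
     (\<lambda>v. - a v *\<^sub>R p u + (b v + triple (hopf (p u)) (x u) y * a v) *\<^sub>R
        imul (cmul (lift_coeff (p u) (x u)) (pstar (p u))))) (at u)"
proof -
  define l where "l = lift_coeff (p u) (x u)"
  define k where "k = triple (hopf (p u)) (x u) y"
  have ll: "cnj l * l = 1"
    unfolding l_def lift_coeff_product[OF p] using x by (simp add: complex_eq_iff)
  \<comment> \<open>\<open>y\<close> may have a component normal to the 2-sphere, but it enters the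
    real part only with the factor \<open>hopf (p u) \<bullet> x u = 0\<close>; so the product is
    purely imaginary.\<close>
  have "cnj l * lift_coeff (p u) y = \<i> * k"
    unfolding l_def k_def lift_coeff_product[OF p] using x by (simp add: complex_eq_iff)
  then have ly: "lift_coeff (p u) y = \<i> * k * l"
    using ll by (metis mult.commute mult.left_commute mult.right_neutral)
  obtain z w where pu: "p u = (z, w)" by (cases "p u")
  obtain c h where xu: "x u = (c, h)" by (cases "x u")
  obtain c' h' where y: "y = (c', h')" by (cases y)
  have l: "l = z\<^sup>2 * cnj c - w\<^sup>2 * c - 2 * z * w * h" by (simp add: l_def lift_coeff_def pu xu)
  define z' w' where "z' = (\<lambda>v. a v * (l * - cnj w) + b v * (\<i> * z))"
    and "w' = (\<lambda>v. a v * (l * cnj z) + b v * (\<i> * w))"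
  define l' where "l' = (\<lambda>v. 2 * z * z' v * cnj c - 2 * w * w' v * c - 2 * (z' v * w + z * w' v) * h + a v * (\<i> * k * l))"
  have "(p has_derivative (\<lambda>v. (z' v, w' v))) (at u)"
    by (rule has_derivative_eq_rhs[OF dp])
      (simp add: z'_def w'_def l_def pu cmul_def pstar_def imul_def scaleR_conv_of_real fun_eq_iff)
  note dz = has_derivative_fst[OF this, simplified] and dw = has_derivative_snd[OF this, simplified]
    and dc = has_derivative_fst[OF dx, simplified] and dh = has_derivative_snd[OF dx, simplified]
  have perp0: "2 * Re (z * cnj w * cnj c) + h * ((cmod z)\<^sup>2 - (cmod w)\<^sup>2) = 0"
    using hopf_inner[of "p u" "x u"] x(1) by (simp add: pu xu)
  then have perp1: "z * cnj w * cnj c + cnj z * w * c + h * (z * cnj z - w * cnj w) = 0"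
    unfolding cmod_power2 by (simp add: complex_eq_iff power2_eq_square algebra_simps)
  have "((\<lambda>u. lift_coeff (p u) (x u)) has_derivative (\<lambda>v.
      (2 * z * z' v * cnj c + z\<^sup>2 * cnj (a v *\<^sub>R c')) - (2 * w * w' v * c + w\<^sup>2 * (a v *\<^sub>R c'))
      - ((2 * z' v * w + 2 * z * w' v) * h + 2 * z * w * of_real (a v * h')))) (at u)"
    unfolding lift_coeff_def
    by (rule derivative_eq_intros dz dw dc dh refl)+ (simp add: pu xu y fun_eq_iff algebra_simps)
  moreover have "(2 * z * z' v * cnj c + z\<^sup>2 * cnj (a v *\<^sub>R c')) - (2 * w * w' v * c + w\<^sup>2 * (a v *\<^sub>R c'))
      - ((2 * z' v * w + 2 * z * w' v) * h + 2 * z * w * of_real (a v * h')) = l' v" for v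
    unfolding l'_def ly[symmetric] lift_coeff_def pu y
    by (simp add: scaleR_conv_of_real algebra_simps)
  ultimately have dl: "((\<lambda>u. lift_coeff (p u) (x u)) has_derivative l') (at u)"
    by simp
  have D: "((\<lambda>u. cmul (lift_coeff (p u) (x u)) (pstar (p u))) has_derivative
     (\<lambda>v. (l * - cnj (w' v) + l' v * - cnj w, l * cnj (z' v) + l' v * cnj z))) (at u)"
    unfolding cmul_def pstar_def fst_conv snd_conv
    by (rule has_derivative_eq_rhs, (rule has_derivative_Pair has_derivative_mult has_derivative_minus
          has_derivative_cnj dl dz dw)+) (simp add: pu l_def)
  show ?thesis
    unfolding l_def[symmetric] k_def[symmetric] unfolding pu
  proof (rule has_derivative_eq_rhs[OF D], rule ext)
    fix v
    \<comment> \<open>Horizontal motion of the point contributes a multiple of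
      \<open>hopf (p u) \<bullet> x u\<close>, zero by \<open>perp1\<close>; motion along the fibre
      reproduces \<open>l\<close> by homogeneity.\<close>
    have "l' v = - 2 * a v * l * (z * cnj w * cnj c + cnj z * w * c + h * (z * cnj z - w * cnj w))
       + 2 * \<i> * b v * (z\<^sup>2 * cnj c - w\<^sup>2 * c - 2 * z * w * h) + a v * (\<i> * k * l)"
      by (simp add: l'_def z'_def w'_def power2_eq_square algebra_simps)
    then have l': "l' v = \<i> * (2 * b v + k * a v) * l"
      unfolding perp1 l[symmetric] by (simp add: algebra_simps)
    have "l * - cnj (w' v) + l' v * - cnj w = - a v * (cnj l * l) * z + \<i> * (b v + k * a v) * (l * - cnj w)"
      by (simp add: l' w'_def algebra_simps)
    moreover have "l * cnj (z' v) + l' v * cnj z = - a v * (cnj l * l) * w + \<i> * (b v + k * a v) * (l * cnj z)"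
      by (simp add: l' z'_def algebra_simps)
    ultimately show "(l * - cnj (w' v) + l' v * - cnj w, l * cnj (z' v) + l' v * cnj z)
        = - a v *\<^sub>R (z, w) + (b v + k * a v) *\<^sub>R imul (cmul l (pstar (z, w)))"
      unfolding ll by (simp add: cmul_def pstar_def imul_def scaleR_conv_of_real algebra_simps)
  qed
qed

section \<open>Charts of a Hopf cylinder\<close>

lemma inner_lift [simp]:
  "p \<bullet> cmul c (pstar p) = 0" "p \<bullet> imul (cmul c (pstar p)) = 0"
  "cmul c (pstar p) \<bullet> cmul c (pstar p) = (cmod c)\<^sup>2 * (p \<bullet> p)"
  by (simp_all add: cmul_def pstar_def imul_def inner_prod_def inner_complex_def cmod_power2
      flip: power2_eq_square) (simp_all add: power2_eq_square algebra_simps)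

lemma lift_coeff_scaleR: "lift_coeff p (r *\<^sub>R x) = r *\<^sub>R lift_coeff p x"
  by (simp add: lift_coeff_def scaleR_conv_of_real algebra_simps)

lemma cmul_scaleR: "cmul (r *\<^sub>R c) p = r *\<^sub>R cmul c p"
  by (simp add: cmul_def)

lemma cmod_lift_coeff:
  assumes "p \<in> S3" "hopf p \<bullet> x = 0" "norm x = 1"
  shows "cmod (lift_coeff p x) = 1"
proof -
  have "complex_of_real ((cmod (lift_coeff p x))\<^sup>2) = cnj (lift_coeff p x) * lift_coeff p x"
    by (metis complex_norm_square mult.commute)
  also have "\<dots> = 1"
    unfolding lift_coeff_product[OF assms(1)] using assms(2,3) by (simp add: complex_eq_iff dot_square_norm)
  finally show ?thesis
    by (metis of_real_eq_1_iff norm_ge_zero power2_eq_1_iff abs_of_nonneg abs_1 power2_abs one_power2 power2_eq_iff_nonneg zero_le_one)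
qed

lemma smooth_curve_derivative:
  assumes "\<And>k. Ck_on k V (g :: real \<Rightarrow> 'a::real_normed_vector)"
  obtains g' where "\<And>s. s \<in> V \<Longrightarrow> (g has_vector_derivative g' s) (at s)" "\<And>k. Ck_on k V g'"
proof
  fix s assume "s \<in> V"
  then have "(g has_derivative frechet_derivative g (at s)) (at s)"
    using assms[of 1] by (simp flip: frechet_derivative_works)
  then have "g differentiable (at s)"
    by (auto simp: differentiable_def)
  then show "(g has_vector_derivative frechet_derivative g (at s) 1) (at s)"
    using frechet_derivative_eq_vector_derivative vector_derivative_works
    by (metis scaleR_one)
next
  show "Ck_on k V (\<lambda>s. frechet_derivative g (at s) 1)" for k
    using assms[of "Suc k"] by simp
qed

lemma inner_constant_deriv:
  assumes "open J" "s \<in> J" "\<And>r. r \<in> J \<Longrightarrow> x r \<bullet> y r = (c::real)"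
    and "(x has_vector_derivative x') (at s)" "(y has_vector_derivative y') (at s)"
  shows "x s \<bullet> y' + x' \<bullet> y s = 0"
proof -
  have "((\<lambda>r. x r \<bullet> y r) has_vector_derivative 0) (at s)"
    by (rule has_vector_derivative_transform_within_open[OF has_vector_derivative_const assms(1,2)])
      (simp add: assms(3))
  with bounded_bilinear.has_vector_derivative[OF bounded_bilinear_inner assms(4,5)]
  show ?thesis by (rule vector_derivative_unique_at)
qed

lemma has_derivative_chain_real:
  assumes "(g has_vector_derivative g') (at (t u))" "(t has_derivative t') (at u)"
  shows "((\<lambda>u. g (t u)) has_derivative (\<lambda>v. t' v *\<^sub>R g')) (at u)"
  using has_derivative_compose[OF assms(2) assms(1)[unfolded has_vector_derivative_def]] by simp

text \<open>In any chart take for \<open>a\<close> the differential of the curve parameter, for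
  \<open>b\<close> the fibre component of the derivative of \<open>f\<close>, and for
  \<open>T\<close> the lift of the unit tangent of the curve.\<close>

lemma hopf_cylinder_chart:
  fixes \<psi> :: "real^2 \<Rightarrow> real \<times> complex \<times> complex"
  assumes I: "is_interval I" and smooth: "smooth_on I \<alpha>" and S2: "\<alpha> ` I \<subseteq> S2"
    and speed: "\<And>t. t \<in> I \<Longrightarrow> norm (vector_derivative \<alpha> (at t within I)) = 1"
    and chart: "local_param (hopf_cylinder I \<alpha>) U \<psi>"
    and G: "\<And>u. u \<in> U \<Longrightarrow> G u = (\<chi> i j. pd i (\<lambda>u. snd (\<psi> u)) u \<bullet> pd j (\<lambda>u. snd (\<psi> u)) u)"
  shows "\<exists>T a b K K1 K2. hopf_frame U (\<lambda>u. snd (\<psi> u)) T a b K K1 K2 G"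
proof -
  have U: "open U" and psi: "\<And>k. Ck_on k U \<psi>" and inj: "\<And>u. u \<in> U \<Longrightarrow> inj (frechet_derivative \<psi> (at u))"
    and im: "\<psi> ` U \<subseteq> hopf_cylinder I \<alpha>"
    using chart by (auto simp: local_param_def smooth_on_open_iff)
  define t where "t = (\<lambda>u. fst (\<psi> u))"
  define f where "f = (\<lambda>u. snd (\<psi> u))"
  have Ckt: "Ck_on k U t" and Ckf: "Ck_on k U f" for k
    unfolding t_def f_def
    using Ck_on_bounded_linear[OF bounded_linear_fst U psi] Ck_on_bounded_linear[OF bounded_linear_snd U psi]
    by blast+
  have tI: "t u \<in> I" and fS: "f u \<in> S3" and hf: "hopf (f u) = \<alpha> (t u)" if "u \<in> U" for u
    using im that by (auto simp: t_def f_def hopf_cylinder_def)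
  define a where "a = (\<lambda>u. frechet_derivative t (at u))"
  define f' where "f' = (\<lambda>u. frechet_derivative f (at u))"
  define b where "b = (\<lambda>u v. f' u v \<bullet> imul (f u))"
  have dt: "(t has_derivative a u) (at u)" and df: "(f has_derivative f' u) (at u)" if "u \<in> U" for u
    using that Ckt[of 1] Ckf[of 1] by (simp_all add: a_def f'_def flip: frechet_derivative_works)
  have dpsi: "frechet_derivative \<psi> (at u) v = (a u v, f' u v)" if "u \<in> U" for u v
    using frechet_derivative_at[OF has_derivative_Pair[OF dt df, OF that that]]
    by (simp add: t_def f_def fun_eq_iff)

  \<comment> \<open>The extension has two-sided derivatives. Four are needed: \<open>K\<close>
    involves the second and is differentiated twice.\<close>
  obtain V g where V: "open V" "I \<subseteq> V" and g: "\<And>k. Ck_on k V g" and eq: "\<And>s. s \<in> I \<Longrightarrow> \<alpha> s = g s"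
    using smooth unfolding smooth_on_def by metis
  obtain g1 where g1: "\<And>s. s \<in> V \<Longrightarrow> (g has_vector_derivative g1 s) (at s)" "\<And>k. Ck_on k V g1"
    by (rule smooth_curve_derivative[OF g]) blast
  obtain g2 where g2: "\<And>s. s \<in> V \<Longrightarrow> (g1 has_vector_derivative g2 s) (at s)" "\<And>k. Ck_on k V g2"
    by (rule smooth_curve_derivative[OF g1(2)]) blast
  obtain g3 where g3: "\<And>s. s \<in> V \<Longrightarrow> (g2 has_vector_derivative g3 s) (at s)" "\<And>k. Ck_on k V g3"
    by (rule smooth_curve_derivative[OF g2(2)]) blast
  obtain g4 where g4: "\<And>s. s \<in> V \<Longrightarrow> (g3 has_vector_derivative g4 s) (at s)"
    by (rule smooth_curve_derivative[OF g3(2)]) blast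
  have tV: "t u \<in> V" if "u \<in> U" for u using tI V(2) that by blast

  define T where "T = (\<lambda>u. cmul (lift_coeff (f u) (g1 (t u))) (pstar (f u)))"
  \<comment> \<open>Under the Hopf map the derivative of \<open>f\<close> becomes
    \<open>a u v\<close> times the velocity of the curve, and the lift is real linear.\<close>
  have f'_eq: "f' u v = a u v *\<^sub>R T u + b u v *\<^sub>R imul (f u)" if u: "u \<in> U" for u v
  proof -
    have "((\<lambda>u. f u \<bullet> f u) has_derivative (\<lambda>v. f u \<bullet> f' u v + f' u v \<bullet> f u)) (at u)"
      by (rule has_derivative_inner[OF df[OF u] df[OF u]])
    moreover have "((\<lambda>u. f u \<bullet> f u) has_derivative (\<lambda>v. 0)) (at u)"
      by (rule has_derivative_transform_within_open[OF has_derivative_const U u, of 1])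
        (use fS in \<open>simp add: dot_square_norm\<close>)
    ultimately have "f u \<bullet> f' u v + f' u v \<bullet> f u = 0"
      by (rule fun_cong[OF has_derivative_unique])
    then have tan: "f' u v \<bullet> f u = 0" by (simp add: inner_commute)
    have "((\<lambda>u. hopf (f u)) has_derivative (\<lambda>v. dhopf (f u) (f' u v))) (at u)"
      unfolding dhopf_def by (rule has_derivative_compose[OF df[OF u] hopf_has_derivative])
    moreover have "((\<lambda>u. hopf (f u)) has_derivative (\<lambda>v. a u v *\<^sub>R g1 (t u))) (at u)"
      by (rule has_derivative_transform_within_open[OF has_derivative_chain_real[OF g1(1)[OF tV[OF u]] dt[OF u]] U u])
        (simp add: hf tI eq)
    ultimately have "dhopf (f u) (f' u v) = a u v *\<^sub>R g1 (t u)"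
      by (rule fun_cong[OF has_derivative_unique])
    then show ?thesis
      using lift_coeff_dhopf[OF fS[OF u] tan]
      by (simp add: T_def b_def lift_coeff_scaleR cmul_scaleR)
  qed
  have a_lin: "linear (a u)" if "u \<in> U" for u using dt[OF that] by (rule has_derivative_linear)
  have b_lin: "linear (b u)" if "u \<in> U" for u
    using has_derivative_linear[OF df[OF that]]
    by (intro linearI) (simp_all add: b_def linear_add linear_scale inner_add_left)
  have ker: "v = 0" if u: "u \<in> U" and "a u v = 0" "b u v = 0" for u v
  proof (rule injD[OF inj[OF u]])
    show "frechet_derivative \<psi> (at u) v = frechet_derivative \<psi> (at u) 0"
      using that linear_0[OF a_lin[OF u]] linear_0[OF b_lin[OF u]]
      by (simp add: dpsi[OF u] f'_eq[OF u])
  qed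
  have coframe: "a u (axis 1 1) * b u (axis 2 1) - a u (axis 2 1) * b u (axis 1 1) \<noteq> 0" (is "?d \<noteq> 0")
    if u: "u \<in> U" for u
  proof
    assume d: "?d = 0"
    define e :: "2 \<Rightarrow> real^2" where "e = (\<lambda>i. axis i 1)"
    have zero: "x = 0 \<and> y = 0" if "x *\<^sub>R e 1 - y *\<^sub>R e 2 = 0" for x y
      using arg_cong[OF that, of "\<lambda>v. v $ 1"] arg_cong[OF that, of "\<lambda>v. v $ 2"]
      by (simp add: e_def axis_def)
    \<comment> \<open>If the determinant vanished, both forms would kill this vector, so it would be
      zero by \<open>ker\<close>; thus \<open>b\<close> vanishes, then likewise \<open>a\<close>,
      which contradicts \<open>ker\<close> at \<open>e 1\<close>.\<close>
    have "b u (e 2) *\<^sub>R e 1 - b u (e 1) *\<^sub>R e 2 = 0"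
      using d by (intro ker[OF u]) (simp_all add: linear_diff linear_scale a_lin b_lin u e_def algebra_simps)
    from zero[OF this] have b0: "b u (e 2) = 0" "b u (e 1) = 0" by auto
    have "a u (e 2) *\<^sub>R e 1 - a u (e 1) *\<^sub>R e 2 = 0"
      using b0 by (intro ker[OF u]) (simp_all add: linear_diff linear_scale a_lin b_lin u e_def algebra_simps)
    from zero[OF this] have "a u (e 1) = 0" by auto
    from ker[OF u this b0(2)] show False by (simp add: e_def)
  qed
  \<comment> \<open>At an end point of \<open>I\<close> the function \<open>t\<close> would be extremal, so \<open>dt\<close> would vanish.\<close>
  have t_int: "t u \<in> interior I" if u: "u \<in> U" for u
  proof (rule ccontr)
    assume "t u \<notin> interior I"
    have "(\<forall>s\<in>I. s \<le> t u) \<or> (\<forall>s\<in>I. t u \<le> s)"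
    proof (rule ccontr)
      assume "\<not> ?thesis"
      then obtain r s where rs: "r \<in> I" "s \<in> I" "r < t u" "t u < s" by (meson not_le)
      then have "{r<..<s} \<subseteq> I"
        using I unfolding is_interval_1 by (meson greaterThanLessThan_iff less_imp_le subsetI)
      then have "t u \<in> interior I"
        using rs by (intro interiorI[of "{r<..<s}"]) auto
      with \<open>t u \<notin> interior I\<close> show False by blast
    qed
    then have "(\<forall>y\<in>U. t y \<le> t u) \<or> (\<forall>y\<in>U. t u \<le> t y)"
      using tI by blast
    from differential_zero_maxmin[OF u U dt[OF u] this] coframe[OF u] show False by simp
  qed
  \<comment> \<open>On the interior the derivative within \<open>I\<close> is the two-sided one and
    equals that of the extension.\<close>
  have unit: "norm (g1 s) = 1" and perp: "g s \<bullet> g1 s = 0" if s: "s \<in> interior I" for s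
  proof -
    have sI: "r \<in> I" if "r \<in> interior I" for r using that interior_subset by blast
    have "(\<alpha> has_vector_derivative g1 s) (at s)"
      by (rule has_vector_derivative_transform_within_open[OF g1(1) open_interior s])
        (use sI[OF s] V(2) eq sI in \<open>simp_all add: subset_iff\<close>)
    then have "vector_derivative \<alpha> (at s within I) = g1 s"
      unfolding at_within_interior[OF s] by (rule vector_derivative_at)
    then show "norm (g1 s) = 1" using speed[OF sI[OF s]] by simp
    have "g r \<bullet> g r = (1/2)\<^sup>2" if "r \<in> interior I" for r
      using S2 eq[OF sI[OF that]] sI[OF that] by (force simp: dot_square_norm)
    moreover have "s \<in> V" using V(2) sI[OF s] by blast
    ultimately show "g s \<bullet> g1 s = 0"
      using inner_constant_deriv[OF open_interior s _ g1(1) g1(1)] by (simp add: inner_commute)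
  qed
  have perp2: "g1 s \<bullet> g2 s = 0" if s: "s \<in> interior I" for s
  proof -
    have "s \<in> V" using s interior_subset V(2) by blast
    then show ?thesis
      using inner_constant_deriv[OF open_interior s _ g2(1) g2(1), of 1] unit
      by (simp add: inner_commute dot_square_norm)
  qed

  \<comment> \<open>In differentiating a triple product the terms with a repeated vector vanish; one
    term survives for \<open>K\<close> and two for \<open>K1\<close>.\<close>
  define K where "K = (\<lambda>u. triple (g (t u)) (g1 (t u)) (g2 (t u)))"
  define K1 where "K1 = (\<lambda>u. triple (g (t u)) (g1 (t u)) (g3 (t u)))"
  define K2 where "K2 = (\<lambda>u. triple (g (t u)) (g2 (t u)) (g3 (t u)) + triple (g (t u)) (g1 (t u)) (g4 (t u)))"
  have "hopf_frame U f T a b K K1 K2 G"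
  proof
    show "open U" "Ck_on 2 U f" by (fact U Ckf)+
    show "G u = (\<chi> i j. pd i f u \<bullet> pd j f u)" if "u \<in> U" for u
      using G[OF that] by (simp add: f_def)
    fix u assume u: "u \<in> U"
    have s: "t u \<in> interior I" by (rule t_int[OF u])
    have hg: "hopf (f u) = g (t u)" using hf[OF u] eq[OF tI[OF u]] by simp
    show df': "(f has_derivative (\<lambda>v. a u v *\<^sub>R T u + b u v *\<^sub>R imul (f u))) (at u)"
      by (rule has_derivative_eq_rhs[OF df[OF u]]) (simp add: fun_eq_iff f'_eq[OF u])
    show "(T has_derivative (\<lambda>v. - a u v *\<^sub>R f u + (b u v + K u * a u v) *\<^sub>R imul (T u))) (at u)"
      unfolding T_def K_def hg[symmetric]
      by (rule has_derivative_lift[OF fS[OF u] _ _ _ df'[unfolded T_def]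
            has_derivative_chain_real[OF g2(1)[OF tV[OF u]] dt[OF u]]])
        (simp_all add: hg perp[OF s] perp2[OF s] unit[OF s] dot_square_norm)
    show "(K has_derivative (\<lambda>v. K1 u * a u v)) (at u)"
      using has_derivative_chain_real[where t = t, OF
          triple_has_real_derivative[OF g1(1) g2(1) g3(1), THEN has_real_derivative_iff_has_vector_derivative[THEN iffD1]] dt[OF u]] tV[OF u]
      by (simp add: K_def K1_def mult.commute)
    show "(K1 has_derivative (\<lambda>v. K2 u * a u v)) (at u)"
      using has_derivative_chain_real[where t = t, OF
          triple_has_real_derivative[OF g1(1) g2(1) g4(1), THEN has_real_derivative_iff_has_vector_derivative[THEN iffD1]] dt[OF u]] tV[OF u]
      by (simp add: K1_def K2_def mult.commute)
    show "(\<lambda>u. a u v) differentiable (at u)" for v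
      using Ckt[of 2] u by (simp add: a_def numeral_2_eq_2)
    show "(\<lambda>u. b u v) differentiable (at u)" for v
    proof -
      have "(\<lambda>u. f' u v) differentiable (at u)"
        using Ckf[of 2] u by (simp add: f'_def numeral_2_eq_2)
      then obtain D where "((\<lambda>u. f' u v) has_derivative D) (at u)"
        by (auto simp: differentiable_def)
      from has_derivative_inner[OF this has_derivative_imul[OF df[OF u]]]
      show ?thesis unfolding b_def differentiable_def by blast
    qed
    show ff: "f u \<bullet> f u = 1" using fS[OF u] by (simp add: dot_square_norm)
    show "T u \<bullet> T u = 1" "f u \<bullet> T u = 0" "f u \<bullet> imul (T u) = 0"
      using cmod_lift_coeff[OF fS[OF u], of "g1 (t u)"] hg perp[OF s] unit[OF s] ff
      by (simp_all add: T_def)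
  qed (rule coframe)
  then show ?thesis unfolding f_def by blast
qed

theorem corollary4p1:
  fixes I :: "real set" and \<alpha> :: "real \<Rightarrow> complex \<times> real"
  assumes "is_interval I"
    and "smooth_on I \<alpha>"
    and "\<alpha> ` I \<subseteq> S2"
    and "\<And>t. t \<in> I \<Longrightarrow> norm (vector_derivative \<alpha> (at t within I)) = 1"
  shows "\<not> proper_biharmonic TYPE(2) (hopf_cylinder I \<alpha>) snd S3"
proof -
  let ?M = "hopf_cylinder I \<alpha>"
  let ?g = "induced_metric ?M snd"
  have "minimal_immersion TYPE(2) ?M snd S3" if bi: "biharmonic_immersion TYPE(2) ?M snd S3"
    unfolding minimal_immersion_def
  proof (intro conjI allI impI ballI)
    show "immersion ?M snd S3" using bi by (simp add: biharmonic_immersion_def)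
    fix U :: "(real^2) set" and \<psi> u
    assume chart: "local_param ?M U \<psi>" and u: "u \<in> U"
    let ?f = "\<lambda>u. snd (\<psi> u)"
    have U: "open U" and im: "\<psi> ` U \<subseteq> ?M" and "\<forall>k. Ck_on k U \<psi>"
      using chart by (auto simp: local_param_def smooth_on_open_iff)
    then have D: "(\<psi> has_derivative frechet_derivative \<psi> (at v)) (at v)" if "v \<in> U" for v
      using that by (simp flip: frechet_derivative_works) (metis Ck_on.simps(2))
    have "snd differentiable (at q within ?M)" for q
      by (auto simp: differentiable_def intro!: bounded_linear_imp_has_derivative bounded_linear_snd)
    \<comment> \<open>The derivative of \<open>snd\<close> within the cylinder is determined on
      tangent vectors only; on those of a chart it is the derivative of \<open>?f\<close>, so the
      induced metric is the first fundamental form of \<open>?f\<close>.\<close>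
    from frechet_derivative_within_chain[OF U _ im this D has_derivative_snd[OF D]]
    have "frechet_derivative snd (at (\<psi> v) within ?M) (pd i \<psi> v) = pd i ?f v" if "v \<in> U" for v i
      using that by (simp add: pd_eqI[OF D[OF that]] pd_eqI[OF has_derivative_snd[OF D[OF that]]])
    then have "metric_coeffs ?g \<psi> v = (\<chi> i j. pd i ?f v \<bullet> pd j ?f v)" if "v \<in> U" for v
      using that by (simp add: metric_coeffs_def induced_metric_def)
    from hopf_cylinder_chart[OF assms chart this]
    obtain T a b K K1 K2 where "hopf_frame U ?f T a b K K1 K2 (metric_coeffs ?g \<psi>)" by blast
    then interpret hopf_frame U ?f T a b K K1 K2 "metric_coeffs ?g \<psi>" .
    have "bitension S3 (metric_coeffs ?g \<psi>) ?f v = 0" if "v \<in> U" for v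
      using bi chart that by (simp add: biharmonic_immersion_def biharmonic_map_def comp_def)
    from minimal_if_biharmonic[OF this u]
    show "mean_curvature S3 (metric_coeffs ?g \<psi>) (snd \<circ> \<psi>) u = 0" by (simp add: comp_def)
  qed
  then show ?thesis by (auto simp: proper_biharmonic_def)
qed

end
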